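(* Let $\boldsymbol\alpha=(\alpha_1,\dots,\alpha_d)$, $\boldsymbol\beta=(\beta_1,\dots,\beta_d)$ be multisets of rational numbers with $\alpha_i\not\equiv\beta_j\pmod{\mathbb{Z}}$ for all $i,j$, and suppose there are positive integers $p_1,\dots,p_r,q_1,\dots,q_s$ with $\gcd(p_1,\dots,q_s)=1$ and $$\prod_{j=1}^d\frac{X-e^{2\pi i\alpha_j}}{X-e^{2\pi i\beta_j}}=\frac{\prod_{i=1}^r(X^{p_i}-1)}{\prod_{j=1}^s(X^{q_j}-1)}.$$ Let $q$ be a prime power such that $(q-1)\alpha_i,(q-1)\beta_j\in\mathbb{Z}$ for all $i,j$ and each $p_i$ and each $q_j$ divides $q-1$. Then for all $t\in\mathbb{F}_q^\times$, $$H_q(\boldsymbol\alpha,\boldsymbol\beta|t)=\frac{(-1)^{r+s}}{1-q}\sum_{m=0}^{q-2}q^{s(m)-s(0)}\prod_{i=1}^rg(p_im)\prod_{j=1}^sg(-q_jm)\,\omega(\epsilon M^{-1}t)^m,$$ where $M=\prod_ip_i^{p_i}\prod_jq_j^{-q_j}$, $\epsilon=(-1)^{\sum_jq_j}$, and $s(m)$ is the multiplicity of $e^{2\pi im/(q-1)}$ as a zero of $D(X)=\gcd\big(\prod_i(X^{p_i}-1),\prod_j(X^{q_j}-1)\big)$.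
   Context: Fix a nontrivial additive character $\psi_q$ of $\mathbb{F}_q$ and a generator $\omega$ of the character group of $\mathbb{F}_q^\times$; $g(m)=\sum_{x\in\mathbb{F}_q^\times}\omega(x)^m\psi_q(x)$ for $m\in\mathbb{Z}$. Write $\bar q=q-1$. The finite hypergeometric sum is $$H_q(\boldsymbol\alpha,\boldsymbol\beta|t)=\frac{1}{1-q}\sum_{m=0}^{q-2}\prod_{i=1}^d\frac{g(m+\alpha_i\bar q)\,g(-m-\beta_i\bar q)}{g(\alpha_i\bar q)\,g(-\beta_i\bar q)}\,\omega((-1)^dt)^m .$$ *)

theory Defs
  imports Complex_Main "HOL-Computational_Algebra.Computational_Algebra" "HOL-Computational_Algebra.Field_as_Ring"
begin

definition add_char :: "('a::{finite,field} \<Rightarrow> complex) \<Rightarrow> bool" where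
  "add_char \<psi> \<longleftrightarrow> (\<forall>x y. \<psi> (x + y) = \<psi> x * \<psi> y) \<and> (\<forall>x. \<psi> x \<noteq> 0)"

definition nontrivial_add_char :: "('a::{finite,field} \<Rightarrow> complex) \<Rightarrow> bool" where
  "nontrivial_add_char \<psi> \<longleftrightarrow> add_char \<psi> \<and> (\<exists>x. \<psi> x \<noteq> 1)"

definition mult_char :: "('a::{finite,field} \<Rightarrow> complex) \<Rightarrow> bool" where
  "mult_char \<omega> \<longleftrightarrow> (\<forall>x y. x \<noteq> 0 \<longrightarrow> y \<noteq> 0 \<longrightarrow> \<omega> (x * y) = \<omega> x * \<omega> y)
                   \<and> (\<forall>x. x \<noteq> 0 \<longrightarrow> \<omega> x \<noteq> 0)"

text \<open>A generator of the character group of the multiplicative group: a multiplicative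
  character of exact order q-1 (as a function on the nonzero elements).\<close>
definition generating_char :: "('a::{finite,field} \<Rightarrow> complex) \<Rightarrow> bool" where
  "generating_char \<omega> \<longleftrightarrow> mult_char \<omega> \<and>
     (\<forall>k::nat. 0 < k \<and> k < card (UNIV :: 'a set) - 1 \<longrightarrow> (\<exists>x. x \<noteq> 0 \<and> \<omega> x ^ k \<noteq> 1))"

definition gauss :: "('a::{finite,field} \<Rightarrow> complex) \<Rightarrow> ('a \<Rightarrow> complex) \<Rightarrow> int \<Rightarrow> complex" where
  "gauss \<psi> \<omega> m = (\<Sum>x\<in>UNIV - {0}. \<omega> x powi m * \<psi> x)"

text \<open>Finite hypergeometric sum; the rational parameters alpha_i, beta_i are given as
  lists of equal length d, and alpha_i * (q-1) is turned into an integer by floor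
  (exact under the hypothesis that it is integral).\<close>
definition hyp_sum :: "('a::{finite,field} \<Rightarrow> complex) \<Rightarrow> ('a \<Rightarrow> complex) \<Rightarrow> rat list \<Rightarrow> rat list
    \<Rightarrow> 'a \<Rightarrow> complex" where
  "hyp_sum \<psi> \<omega> as bs t =
     (1 / (1 - of_nat (card (UNIV :: 'a set)))) *
     (\<Sum>m = 0..card (UNIV :: 'a set) - 2.
        (\<Prod>i<length as.
           gauss \<psi> \<omega> (int m + \<lfloor>as ! i * of_nat (card (UNIV :: 'a set) - 1)\<rfloor>)
           * gauss \<psi> \<omega> (- int m - \<lfloor>bs ! i * of_nat (card (UNIV :: 'a set) - 1)\<rfloor>)
           / (gauss \<psi> \<omega> \<lfloor>as ! i * of_nat (card (UNIV :: 'a set) - 1)\<rfloor>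
              * gauss \<psi> \<omega> (- \<lfloor>bs ! i * of_nat (card (UNIV :: 'a set) - 1)\<rfloor>)))
        * \<omega> ((-1) ^ length as * t) ^ m)"

definition expi :: "rat \<Rightarrow> complex" where
  "expi a = exp (2 * of_real pi * \<i> * of_rat a)"

definition xpm1 :: "nat \<Rightarrow> complex poly" where
  "xpm1 n = monom 1 n - 1"

end

theory Submission
  imports Defs "HOL-Algebra.Algebraic_Closure_Type"
begin

text \<open>
  After cancelling common zeros, the product over the \<open>\<alpha>\<^sub>i\<close> and \<open>\<beta>\<^sub>i\<close> is the product over all zeros of
  the \<open>X\<^bsup>p\<^esup> - 1\<close> and \<open>X\<^bsup>q\<^esup> - 1\<close> divided by the product over the zeros of \<open>D\<close>. The zeros of \<open>D\<close> contribute
  quotients of reflected pairs \<open>g(m + c) g(- m - c)\<close>, hence the powers of the field size, and the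
  zeros of \<open>X\<^bsup>p\<^esup> - 1\<close> contribute \<open>g(p m)\<close> by the Hasse--Davenport product formula.

  To prove the latter for \<open>N\<close> dividing \<open>q - 1\<close>, attach to \<open>\<chi> = \<omega>\<^bsup>m\<^esup>\<close> the \<open>L\<close>-series over
  monic polynomials \<open>f\<close> with \<open>f(0) \<noteq> 0\<close>, weighted by \<open>\<chi>\<close> of the product and \<open>\<psi>\<close> of the sum of the roots;
  it equals \<open>1 + g(m) T\<close>. Weighting instead by the \<open>N\<close>-th powers of the roots gives, by comparing
  logarithmic derivatives over all extensions of the field, the product of the \<open>L\<close>-series of
  \<open>\<chi> \<rho>\<^bsup>j\<^esup>\<close>, \<open>j < N\<close>, where \<open>\<rho>\<close> has order \<open>N\<close>. Its coefficient at \<open>T\<^bsup>N\<^esup>\<close> is therefore the product of the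
  \<open>g(m + j (q - 1) / N)\<close>; on the other hand the \<open>N\<close>-th power sum of the roots is affine in the
  constant coefficient of \<open>f\<close>, so summing over that coefficient yields \<open>g(N m)\<close> times a
  constant, which is found by taking \<open>m = 0\<close>.
\<close>

hide_const (open) Coset.order Polynomials.lead_coeff up_ring.monom up_ring.coeff Polynomials.degree
  Divisibility.prime

section \<open>Weighted sums over stable multisets\<close>

text \<open>The period \<open>k\<close> need not be minimal: if it is \<open>e\<close> times the
  minimal period of \<open>z\<close>, every point of the orbit occurs \<open>e\<close> times. For
  Frobenius these are points of the degree \<open>k\<close> extension lying in a smaller
  extension.\<close>

definition orbit_mset :: "('b \<Rightarrow> 'b) \<Rightarrow> nat \<Rightarrow> 'b \<Rightarrow> 'b multiset" where
  "orbit_mset F k z = image_mset (\<lambda>i. (F ^^ i) z) (mset_set {..<k})"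

definition stable_mset :: "('b \<Rightarrow> 'b) \<Rightarrow> 'b set \<Rightarrow> 'b multiset \<Rightarrow> bool" where
  "stable_mset F V M \<longleftrightarrow> image_mset F M = M \<and> set_mset M \<subseteq> V"

lemma size_orbit_mset [simp]: "size (orbit_mset F k z) = k"
  by (simp add: orbit_mset_def)

lemma orbit_mset_0 [simp]: "orbit_mset F 0 z = {#}"
  by (simp add: orbit_mset_def)

lemma orbit_mset_Suc: "orbit_mset F (Suc k) z = add_mset ((F ^^ k) z) (orbit_mset F k z)"
  by (simp add: orbit_mset_def lessThan_Suc)

lemma orbit_mset_add: "orbit_mset F (k + l) z = orbit_mset F k z + orbit_mset F l ((F ^^ k) z)"
proof (induction l)
  case (Suc l)
  have "(F ^^ (k + l)) z = (F ^^ l) ((F ^^ k) z)"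
    by (metis add.commute comp_apply funpow_add)
  thus ?case using Suc by (simp add: orbit_mset_Suc)
qed simp

lemma orbit_mset_mult:
  assumes "(F ^^ d) z = z"
  shows "orbit_mset F (d * e) z = repeat_mset e (orbit_mset F d z)"
proof (induction e)
  case (Suc e)
  have "orbit_mset F (d + d * e) z = orbit_mset F d z + orbit_mset F (d * e) z"
    by (simp add: orbit_mset_add assms)
  thus ?case by (simp add: Suc)
qed simp

lemma image_orbit_mset_eq:
  assumes "(F ^^ k) z = z"
  shows "image_mset F (orbit_mset F k z) = orbit_mset F k z"
proof -
  have "image_mset F (orbit_mset F k z) + {#z#} = add_mset ((F ^^ k) z) (orbit_mset F k z)"
    by (induction k) (auto simp: orbit_mset_Suc)
  thus ?thesis using assms by simp
qed

lemma fps_X_mult_deriv_nth: "(fps_X * fps_deriv P) $ n = of_nat n * P $ n"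
  by (cases n) auto

text \<open>The periods of \<open>z\<close> are the multiples \<open>d * e\<close> of its minimal
  period \<open>d\<close>, and \<open>orbit_mset F (d * e) z\<close> repeats each of
  \<open>d\<close> distinct points \<open>e\<close> times. In a stable \<open>M\<close> all these
  points have the multiplicity of \<open>z\<close>, so containment amounts to
  \<open>e \<le> count M z\<close>.\<close>

lemma card_periods_eq_count:
  assumes inj: "inj F" and stab: "image_mset F M = M" and z: "z \<in># M"
  shows "finite {k. 0 < k \<and> (F ^^ k) z = z \<and> orbit_mset F k z \<subseteq># M}"
    and "card {k. 0 < k \<and> (F ^^ k) z = z \<and> orbit_mset F k z \<subseteq># M} = count M z"
proof -
  have cF: "count M (F x) = count M x" for x
  proof -
    have "F -` {F x} \<inter> set_mset M = (if x \<in># M then {x} else {})"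
      using inj by (auto dest: injD)
    hence "count (image_mset F M) (F x) = count M x"
      by (auto simp: count_image_mset not_in_iff)
    thus ?thesis using stab by simp
  qed
  have cFi: "count M ((F ^^ i) z) = count M z" for i
    by (induction i) (auto simp: cF)
  have injn: "inj (F ^^ n)" for n using inj by (rule inj_fn)
  \<comment> \<open>The orbit stays inside the finite support of \<open>M\<close>, so two iterates
    coincide; injectivity cancels the earlier one.\<close>
  have "\<exists>d>0. (F ^^ d) z = z"
  proof -
    have "range (\<lambda>i. (F ^^ i) z) \<subseteq> set_mset M"
      using cFi z by (metis count_greater_zero_iff image_subsetI)
    hence "finite (range (\<lambda>i. (F ^^ i) z))" by (rule finite_subset) simp
    hence "\<not> inj (\<lambda>i. (F ^^ i) z)" using finite_imageD by blast
    then obtain i j where ij: "i < j" "(F ^^ i) z = (F ^^ j) z"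
      unfolding inj_def by (metis linorder_neqE_nat)
    have "(F ^^ j) z = (F ^^ i) ((F ^^ (j - i)) z)"
      using ij(1) by (metis comp_apply funpow_add le_add_diff_inverse less_or_eq_imp_le)
    hence "(F ^^ (j - i)) z = z" using ij(2) injn[of i] by (metis injD)
    thus ?thesis using ij(1) by (intro exI[of _ "j - i"]) auto
  qed
  define d where "d = (LEAST d. 0 < d \<and> (F ^^ d) z = z)"
  have d: "0 < d" "(F ^^ d) z = z"
    using LeastI_ex[OF \<open>\<exists>d>0. (F ^^ d) z = z\<close>] unfolding d_def by auto
  have dmin: "\<not> (0 < e \<and> (F ^^ e) z = z)" if "e < d" for e
    using that not_less_Least unfolding d_def by blast
  have mult: "(F ^^ (d * e)) z = z" for e
    using d by (induction e) (simp_all add: funpow_add)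
  have per: "(F ^^ k) z = z \<longleftrightarrow> d dvd k" for k
  proof
    assume k: "(F ^^ k) z = z"
    have "(F ^^ (k mod d + d * (k div d))) z = (F ^^ (k mod d)) z"
      by (simp only: funpow_add comp_apply mult)
    hence "(F ^^ (k mod d)) z = z" using k by simp
    hence "k mod d = 0" using dmin[of "k mod d"] d(1) by auto
    thus "d dvd k" by auto
  qed (use mult in auto)
  have "inj_on (\<lambda>i. (F ^^ i) z) {..<d}"
  proof (rule linorder_inj_onI)
    fix i j assume ij: "i < j" "i \<in> {..<d}" "j \<in> {..<d}"
    show "(F ^^ i) z \<noteq> (F ^^ j) z"
    proof
      assume eq: "(F ^^ i) z = (F ^^ j) z"
      have "(F ^^ j) z = (F ^^ i) ((F ^^ (j - i)) z)"
        using ij(1) by (metis comp_apply funpow_add le_add_diff_inverse less_or_eq_imp_le)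
      hence "(F ^^ (j - i)) z = z" using eq injn[of i] by (metis injD)
      thus False using dmin[of "j - i"] ij by (simp add: less_imp_diff_less)
    qed
  qed auto
  hence od: "orbit_mset F d z = mset_set ((\<lambda>i. (F ^^ i) z) ` {..<d})"
    by (simp add: orbit_mset_def image_mset_mset_set)
  have sub: "orbit_mset F (d * e) z \<subseteq># M \<longleftrightarrow> e \<le> count M z" for e
  proof
    assume "orbit_mset F (d * e) z \<subseteq># M"
    hence "count (orbit_mset F (d * e) z) z \<le> count M z" by (rule mset_subset_eq_count)
    moreover have "z \<in> (\<lambda>i. (F ^^ i) z) ` {..<d}" using d(1) by (intro image_eqI[of _ _ 0]) auto
    ultimately show "e \<le> count M z"
      by (simp add: orbit_mset_mult d od)
  next
    assume e: "e \<le> count M z"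
    show "orbit_mset F (d * e) z \<subseteq># M"
    proof (rule mset_subset_eqI)
      fix a
      show "count (orbit_mset F (d * e) z) a \<le> count M a"
        using e cFi by (auto simp: orbit_mset_mult d od count_mset_set')
    qed
  qed
  have eq: "{k. 0 < k \<and> (F ^^ k) z = z \<and> orbit_mset F k z \<subseteq># M} = (\<lambda>e. d * e) ` {1..count M z}"
    using d(1) by (fastforce simp: per sub elim!: dvdE)
  show "finite {k. 0 < k \<and> (F ^^ k) z = z \<and> orbit_mset F k z \<subseteq># M}"
    unfolding eq by simp
  have "inj_on (\<lambda>e. d * e) {1..count M z}" using d(1) by (auto simp: inj_on_def)
  thus "card {k. 0 < k \<and> (F ^^ k) z = z \<and> orbit_mset F k z \<subseteq># M} = count M z"
    unfolding eq by (simp add: card_image)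
qed

section \<open>Newton's recursion for multiplicative weights\<close>

locale frobenius_weight =
  fixes F :: "'b \<Rightarrow> 'b" and V :: "'b set" and w :: "'b multiset \<Rightarrow> complex"
  assumes inj: "inj F" and maps: "\<And>z. z \<in> V \<Longrightarrow> F z \<in> V"
    and fin_fix: "\<And>k. 0 < k \<Longrightarrow> finite {z\<in>V. (F ^^ k) z = z}"
    and w_empty: "w {#} = 1"
    and w_add: "\<And>M M'. stable_mset F V M \<Longrightarrow> stable_mset F V M' \<Longrightarrow> w (M + M') = w M * w M'"
begin

definition stab :: "nat \<Rightarrow> 'b multiset set" where
  "stab n = {M. stable_mset F V M \<and> size M = n}"

definition fixpts :: "nat \<Rightarrow> 'b set" where "fixpts k = {z\<in>V. (F ^^ k) z = z}"

text \<open>Coefficient of an L-series: a stable multiset of size \<open>n\<close> stands for an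
  effective divisor of degree \<open>n\<close>, and \<open>w\<close> for a multiplicative function
  on such divisors.\<close>

definition L_coeff :: "nat \<Rightarrow> complex" where "L_coeff n = (\<Sum>M\<in>stab n. w M)"

text \<open>Coefficients of the logarithmic derivative \<open>T L' / L\<close>, as character sums
  over the points of the degree \<open>k\<close> extension. Since \<open>fixpts 0\<close> is all of
  \<open>V\<close>, the value at \<open>k = 0\<close> is set to 0, which is the correct constant
  term.\<close>

definition trace_sum :: "nat \<Rightarrow> complex" where
  "trace_sum k = (if k = 0 then 0 else (\<Sum>z\<in>fixpts k. w (orbit_mset F k z)))"

lemma finite_fixpts: "0 < k \<Longrightarrow> finite (fixpts k)"
  using fin_fix by (simp add: fixpts_def)

lemma funpow_maps: "z \<in> V \<Longrightarrow> (F ^^ k) z \<in> V"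
  by (induction k) (auto intro: maps)

lemma stable_orbit: "z \<in> fixpts k \<Longrightarrow> stable_mset F V (orbit_mset F k z)"
  by (auto simp: stable_mset_def fixpts_def image_orbit_mset_eq) (auto simp: orbit_mset_def intro: funpow_maps)

text \<open>Each element of a stable multiset of size \<open>n\<close> lies in an orbit contained in
  it, hence has a period at most \<open>n\<close>. So all elements come from one finite set of
  periodic points.\<close>

lemma finite_stab: "finite (stab n)"
proof -
  define Y where "Y = (\<Union>k\<in>{1..n}. fixpts k)"
  have "finite Y" using fin_fix unfolding Y_def fixpts_def by auto
  have "M \<in> mset ` {xs. set xs \<subseteq> Y \<and> length xs = n}" if M: "M \<in> stab n" for M
  proof -
    have "z \<in> Y" if z: "z \<in># M" for z
    proof -
      have st: "image_mset F M = M" using M by (simp add: stab_def stable_mset_def)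
      have "card {k. 0 < k \<and> (F ^^ k) z = z \<and> orbit_mset F k z \<subseteq># M} > 0"
        using card_periods_eq_count(2)[OF inj st z] z by simp
      then obtain k where k: "0 < k" "(F ^^ k) z = z" "orbit_mset F k z \<subseteq># M"
        by (metis (mono_tags, lifting) Collect_empty_eq card.empty less_irrefl)
      have "k \<le> n" using size_mset_mono[OF k(3)] M by (simp add: stab_def)
      thus ?thesis using k z M unfolding Y_def by (auto simp: fixpts_def stab_def stable_mset_def)
    qed
    moreover obtain xs where "M = mset xs" by (metis ex_mset)
    ultimately show ?thesis using M by (auto simp: stab_def)
  qed
  hence "stab n \<subseteq> mset ` {xs. set xs \<subseteq> Y \<and> length xs = n}" by blast
  thus ?thesis using finite_lists_length_eq[OF \<open>finite Y\<close>] by (meson finite_imageI finite_subset)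
qed

text \<open>Removing one copy of the orbit is a bijection onto the stable multisets of size
  \<open>n - k\<close>, and \<open>w\<close> is multiplicative.\<close>

lemma sum_stab_containing:
  assumes k: "k \<le> n" and z: "z \<in> fixpts k"
  shows "(\<Sum>M\<in>{M\<in>stab n. orbit_mset F k z \<subseteq># M}. w M) = w (orbit_mset F k z) * L_coeff (n - k)"
proof -
  let ?O = "orbit_mset F k z"
  have st: "stable_mset F V ?O" using stable_orbit[OF z] .
  have "(\<Sum>M\<in>{M\<in>stab n. ?O \<subseteq># M}. w M) = (\<Sum>M\<in>stab (n - k). w ?O * w M)"
  proof (rule sum.reindex_bij_witness[of _ "\<lambda>M. M + ?O" "\<lambda>M. M - ?O"], goal_cases)
    case (2 M)
    hence "image_mset F (M - ?O) = M - ?O"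
      using st by (simp add: stab_def stable_mset_def image_mset_Diff)
    thus ?case using 2 by (auto simp: stab_def stable_mset_def size_Diff_submset dest: in_diffD)
  next
    case (4 M)
    thus ?case using st k by (auto simp: stab_def stable_mset_def)
  next
    case (5 M)
    hence "image_mset F (M - ?O) = M - ?O"
      using st by (simp add: stab_def stable_mset_def image_mset_Diff)
    hence "stable_mset F V (M - ?O)" using 5 by (auto simp: stab_def stable_mset_def dest: in_diffD)
    hence "w (?O + (M - ?O)) = w ?O * w (M - ?O)" by (rule w_add[OF st])
    thus ?case using 5 by simp
  qed auto
  thus ?thesis by (simp add: L_coeff_def sum_distrib_left)
qed

text \<open>A stable multiset \<open>M\<close> contains exactly \<open>size M\<close> closed orbits \<open>orbit_mset F k z\<close>
  with a marked point, so both sides count pairs of a multiset and a marked orbit in it.\<close>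
lemma newton_recursion:
  "of_nat n * L_coeff n = (\<Sum>k=1..n. trace_sum k * L_coeff (n - k))"
proof -
  have "of_nat n * w M = (\<Sum>k=1..n. \<Sum>z\<in>fixpts k. if orbit_mset F k z \<subseteq># M then w M else 0)"
    if M: "M \<in> stab n" for M
  proof -
    have st: "image_mset F M = M" and MV: "set_mset M \<subseteq> V" and sz: "size M = n"
      using M by (auto simp: stab_def stable_mset_def)
    let ?T = "\<lambda>z. {k. 0 < k \<and> (F ^^ k) z = z \<and> orbit_mset F k z \<subseteq># M}"
    have "n = (\<Sum>z\<in>set_mset M. card (?T z))"
      using sz by (simp add: size_multiset_overloaded_eq card_periods_eq_count(2)[OF inj st])
    also have "\<dots> = card (SIGMA z:set_mset M. ?T z)"
      by (subst card_SigmaI) (auto intro: card_periods_eq_count(1)[OF inj st])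
    also have "\<dots> = card (SIGMA k:{1..n}. {z\<in>fixpts k. orbit_mset F k z \<subseteq># M})"
    proof (rule bij_betw_same_card[of prod.swap], rule bij_betw_byWitness[of _ prod.swap])
      show "prod.swap ` (SIGMA z:set_mset M. ?T z) \<subseteq> (SIGMA k:{1..n}. {z\<in>fixpts k. orbit_mset F k z \<subseteq># M})"
        using MV sz by (auto simp: fixpts_def dest: size_mset_mono)
      show "prod.swap ` (SIGMA k:{1..n}. {z\<in>fixpts k. orbit_mset F k z \<subseteq># M}) \<subseteq> (SIGMA z:set_mset M. ?T z)"
      proof -
        have "z \<in># M \<and> 0 < k \<and> (F ^^ k) z = z"
          if k: "1 \<le> k" "z \<in> fixpts k" "orbit_mset F k z \<subseteq># M" for k z
        proof -
          have "z \<in># orbit_mset F k z"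
            using k(1) unfolding orbit_mset_def by (auto intro!: image_eqI[of _ _ 0])
          thus ?thesis using k by (auto simp: fixpts_def dest: mset_subset_eqD)
        qed
        thus ?thesis by auto
      qed
    qed auto
    also have "\<dots> = (\<Sum>k=1..n. card {z\<in>fixpts k. orbit_mset F k z \<subseteq># M})"
      by (subst card_SigmaI) (auto intro!: finite_Collect_conjI finite_fixpts)
    finally have *: "n = (\<Sum>k=1..n. card {z\<in>fixpts k. orbit_mset F k z \<subseteq># M})" .
    have "of_nat n = (\<Sum>k=1..n. (\<Sum>z\<in>{z\<in>fixpts k. orbit_mset F k z \<subseteq># M}. 1 :: complex))"
      using arg_cong[OF *, of complex_of_nat] by simp
    hence "of_nat n * w M = (\<Sum>k=1..n. (\<Sum>z\<in>{z\<in>fixpts k. orbit_mset F k z \<subseteq># M}. w M))"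
      by (simp add: sum_distrib_right)
    also have "\<dots> = (\<Sum>k=1..n. \<Sum>z\<in>fixpts k. if orbit_mset F k z \<subseteq># M then w M else 0)"
      using fin_fix by (intro sum.cong sum.inter_filter refl) (auto simp: fixpts_def)
    finally show ?thesis .
  qed
  hence "of_nat n * L_coeff n =
      (\<Sum>M\<in>stab n. \<Sum>k=1..n. \<Sum>z\<in>fixpts k. if orbit_mset F k z \<subseteq># M then w M else 0)"
    unfolding L_coeff_def sum_distrib_left by (intro sum.cong) auto
  also have "\<dots> = (\<Sum>k=1..n. \<Sum>M\<in>stab n. \<Sum>z\<in>fixpts k. if orbit_mset F k z \<subseteq># M then w M else 0)"
    by (rule sum.swap)
  also have "\<dots> = (\<Sum>k=1..n. \<Sum>z\<in>fixpts k. \<Sum>M\<in>stab n. if orbit_mset F k z \<subseteq># M then w M else 0)"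
    by (intro sum.cong refl sum.swap)
  also have "\<dots> = (\<Sum>k=1..n. \<Sum>z\<in>fixpts k. w (orbit_mset F k z) * L_coeff (n - k))"
    by (intro sum.cong refl) (simp add: sum.inter_filter[symmetric] finite_stab sum_stab_containing)
  also have "\<dots> = (\<Sum>k=1..n. trace_sum k * L_coeff (n - k))"
    by (intro sum.cong refl) (auto simp: trace_sum_def sum_distrib_right)
  finally show ?thesis .
qed

lemma L_coeff_0 [simp]: "L_coeff 0 = 1"
proof -
  have "stab 0 = {{#}}" by (auto simp: stab_def stable_mset_def)
  thus ?thesis by (simp add: L_coeff_def w_empty)
qed

lemma L_series_deriv:
  "fps_X * fps_deriv (Abs_fps L_coeff) = Abs_fps trace_sum * Abs_fps L_coeff"
proof (rule fps_ext)
  fix n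
  have "(\<Sum>k=0..n. trace_sum k * L_coeff (n - k)) = (\<Sum>k=1..n. trace_sum k * L_coeff (n - k))"
    by (simp add: sum.atLeast_Suc_atMost trace_sum_def)
  thus "(fps_X * fps_deriv (Abs_fps L_coeff)) $ n = (Abs_fps trace_sum * Abs_fps L_coeff) $ n"
    using newton_recursion[of n] unfolding fps_X_mult_deriv_nth unfolding fps_mult_nth by simp
qed

end

section \<open>Formal power series with given logarithmic derivative\<close>

lemma fps_log_deriv_unique:
  fixes L L' S :: "complex fps"
  assumes "fps_X * fps_deriv L = S * L" "fps_X * fps_deriv L' = S * L'"
    and "S $ 0 = 0" "L $ 0 = L' $ 0"
  shows "L = L'"
proof (rule fps_ext)
  fix n show "L $ n = L' $ n"
  proof (induction n rule: less_induct)
    case (less n)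
    show ?case
    proof (cases n)
      case (Suc m)
      \<comment> \<open>As \<open>S\<close> has no constant term, only coefficients of
        \<open>P\<close> below \<open>n\<close> occur on the right; in characteristic zero the
        factor \<open>n\<close> can then be cancelled.\<close>
      have rec: "of_nat n * P $ n = (\<Sum>k=1..n. S $ k * P $ (n - k))" if "fps_X * fps_deriv P = S * P" for P
      proof -
        have "(fps_X * fps_deriv P) $ n = (S * P) $ n" using that by simp
        thus ?thesis unfolding fps_X_mult_deriv_nth unfolding fps_mult_nth
          using assms(3) by (simp add: sum.atLeast_Suc_atMost)
      qed
      have "of_nat n * L $ n = of_nat n * L' $ n"
        unfolding rec[OF assms(1)] rec[OF assms(2)] using less Suc by (intro sum.cong) auto
      thus ?thesis using Suc by (simp del: of_nat_Suc)
    qed (use assms in simp)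
  qed
qed

lemma fps_log_deriv_prod:
  fixes L S :: "'i \<Rightarrow> complex fps"
  assumes "finite I" "\<And>i. i \<in> I \<Longrightarrow> fps_X * fps_deriv (L i) = S i * L i"
  shows "fps_X * fps_deriv (\<Prod>i\<in>I. L i) = (\<Sum>i\<in>I. S i) * (\<Prod>i\<in>I. L i)"
  using assms
proof (induction rule: finite_induct)
  case (insert i I)
  have "fps_X * fps_deriv (L i * prod L I) = (fps_X * fps_deriv (L i)) * prod L I + L i * (fps_X * fps_deriv (prod L I))"
    by (simp add: algebra_simps)
  also have "\<dots> = (S i * L i) * prod L I + L i * (sum S I * prod L I)"
    using insert by auto
  finally show ?case using insert by (simp add: algebra_simps)
qed simp

lemma fps_nth_0_prod: "(\<Prod>i\<in>I. f i :: 'b::comm_ring_1 fps) $ 0 = (\<Prod>i\<in>I. f i $ 0)"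
  by (induction I rule: infinite_finite_induct) auto

text \<open>This extracts the product of Gauss sums from a product of L-series of degree at most
  one. By the bound \<open>hi\<close> on the degree of the partial products, only the linear terms
  contribute to the top coefficient.\<close>

lemma fps_prod_linear_top_coeff:
  "(\<Prod>j<N. 1 + fps_const (g j) * fps_X :: complex fps) $ N = (\<Prod>j<N. g j)"
proof -
  have hi: "(\<Prod>j<N. 1 + fps_const (g j) * fps_X :: complex fps) $ k = 0" if "k > N" for N k
    using that
  proof (induction N arbitrary: k)
    case (Suc N)
    thus ?case by (cases k) (auto simp: algebra_simps)
  qed auto
  show ?thesis by (induction N) (auto simp: distrib_left hi simp flip: mult.assoc)
qed

section \<open>Characters and Gauss sums of a finite field\<close>

text \<open>Lagrange's argument: multiplication by \<open>x\<close> permutes \<open>H\<close>, and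
  the product of all elements of \<open>H\<close> can be cancelled.\<close>

lemma power_card_eq_1:
  fixes H :: "'b::field set"
  assumes "finite H" "0 \<notin> H" "\<And>x y. x \<in> H \<Longrightarrow> y \<in> H \<Longrightarrow> x * y \<in> H" "x \<in> H"
  shows "x ^ card H = 1"
proof -
  have inj: "inj_on ((*) x) H" using assms by (auto simp: inj_on_def)
  have "(*) x ` H = H"
    using assms inj by (intro endo_inj_surj) auto
  hence "prod id H = (\<Prod>y\<in>H. x * y)"
    using inj by (metis (mono_tags, lifting) comp_def id_apply prod.cong prod.reindex)
  also have "\<dots> = x ^ card H * prod id H" by (simp add: prod.distrib)
  finally show ?thesis using assms by auto
qed

lemma finite_field_power_card_minus_1:
  fixes x :: "'a::{finite,field}"
  assumes "x \<noteq> 0"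
  shows "x ^ (card (UNIV :: 'a set) - 1) = 1"
  using power_card_eq_1[of "UNIV - {0::'a}" x] assms by (simp add: card_Diff_singleton)

lemma finite_field_card_gt_1: "1 < card (UNIV :: 'a::{finite,field} set)"
proof -
  have "card {0, 1 :: 'a} \<le> card (UNIV :: 'a set)" by (rule card_mono) auto
  thus ?thesis by simp
qed

locale field_characters =
  fixes \<psi> \<omega> :: "'a::{finite,field} \<Rightarrow> complex"
  assumes psi: "nontrivial_add_char \<psi>" and omega: "generating_char \<omega>"
    and primepow: "\<exists>p k. prime p \<and> 0 < k \<and> card (UNIV :: 'a set) = p ^ k"
begin

definition q :: nat where "q = card (UNIV :: 'a set)"
definition n :: nat where "n = q - 1"

lemma n_pos: "0 < n" and q_eq: "q = Suc n"
  using finite_field_card_gt_1[where 'a='a] by (auto simp: n_def q_def)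

lemma pow_n: "x \<noteq> 0 \<Longrightarrow> x ^ n = (1::'a)"
  using finite_field_power_card_minus_1[of x] by (simp add: n_def q_def)

lemma psi_add: "\<psi> (x + y) = \<psi> x * \<psi> y" and psi_nz: "\<psi> x \<noteq> 0"
  using psi by (auto simp: nontrivial_add_char_def add_char_def)

lemma psi_0 [simp]: "\<psi> 0 = 1"
  using psi_add[of 0 0] psi_nz[of 0] by simp

lemma omega_mult: "x \<noteq> 0 \<Longrightarrow> y \<noteq> 0 \<Longrightarrow> \<omega> (x * y) = \<omega> x * \<omega> y"
  and omega_nz: "x \<noteq> 0 \<Longrightarrow> \<omega> x \<noteq> 0"
  using omega by (auto simp: generating_char_def mult_char_def)

lemma omega_1 [simp]: "\<omega> 1 = 1"
  using omega_mult[of 1 1] omega_nz[of 1] by simp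

lemma omega_power: "x \<noteq> 0 \<Longrightarrow> \<omega> (x ^ k) = \<omega> x ^ k"
  by (induction k) (auto simp: omega_mult)

lemma omega_inverse: "x \<noteq> 0 \<Longrightarrow> \<omega> (inverse x) = inverse (\<omega> x)"
  using omega_mult[of x "inverse x"] by (simp add: inverse_unique)

lemma omega_pow_n: "x \<noteq> 0 \<Longrightarrow> \<omega> x ^ n = 1"
  using omega_power[of x n] by (simp add: pow_n)

text \<open>If the image had fewer than \<open>q - 1\<close> elements, its cardinality would be a
  smaller positive exponent trivialising \<open>\<omega>\<close>, against
  \<open>generating_char\<close>.\<close>

lemma omega_inj: "inj_on \<omega> (UNIV - {0})"
proof -
  let ?H = "\<omega> ` (UNIV - {0})"
  have "x ^ card ?H = 1" if "x \<in> ?H" for x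
  proof (rule power_card_eq_1[OF _ _ _ that])
    show "x * y \<in> ?H" if "x \<in> ?H" "y \<in> ?H" for x y
    proof -
      from that obtain a b where "x = \<omega> a" "y = \<omega> b" "a \<noteq> 0" "b \<noteq> 0" by auto
      thus ?thesis by (intro image_eqI[of _ _ "a * b"]) (auto simp: omega_mult)
    qed
  qed (use omega_nz in force)+
  hence "\<not> (0 < card ?H \<and> card ?H < card (UNIV :: 'a set) - 1)"
    using omega unfolding generating_char_def by blast
  moreover have "0 < card ?H"
  proof -
    have "1 \<in> ?H" by (intro image_eqI[of _ _ 1]) auto
    thus ?thesis by (subst card_gt_0_iff) auto
  qed
  ultimately have "card ?H \<ge> card (UNIV - {0::'a})" by (simp add: card_Diff_singleton)
  moreover have "card ?H \<le> card (UNIV - {0::'a})" by (intro card_image_le) simp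
  ultimately show ?thesis by (intro eq_card_imp_inj_on) simp_all
qed

lemma omega_eq_1_iff: "x \<noteq> 0 \<Longrightarrow> \<omega> x = 1 \<longleftrightarrow> x = 1"
  using inj_onD[OF omega_inj, of x 1] by auto

lemma omega_image: "\<omega> ` (UNIV - {0}) = {z. z ^ n = 1}"
proof (rule card_subset_eq)
  show "finite {z::complex. z ^ n = 1}" using n_pos by (intro finite_roots_unity) auto
  show "\<omega> ` (UNIV - {0}) \<subseteq> {z. z ^ n = 1}" by (auto simp: omega_pow_n)
  have "card (\<omega> ` (UNIV - {0})) = n"
    by (simp add: card_image[OF omega_inj] card_Diff_singleton n_def q_def)
  thus "card (\<omega> ` (UNIV - {0})) = card {z::complex. z ^ n = 1}"
    using card_roots_unity_eq[of n] n_pos by simp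
qed

lemma omega_powi_mult: "x \<noteq> 0 \<Longrightarrow> y \<noteq> 0 \<Longrightarrow> \<omega> (x * y) powi m = \<omega> x powi m * \<omega> y powi m"
  by (simp add: omega_mult power_int_mult_distrib)

lemma omega_powi_mod:
  assumes "x \<noteq> 0" "m mod int n = m' mod int n"
  shows "\<omega> x powi m = \<omega> x powi m'"
proof -
  obtain k where k: "m = m' + int n * k"
    using assms(2) by (metis mod_eqE)
  have "\<omega> x powi (int n * k) = 1"
    by (simp add: power_int_mult omega_pow_n assms)
  thus ?thesis by (simp add: k power_int_add omega_nz assms)
qed

lemma gauss_mod: "m mod int n = m' mod int n \<Longrightarrow> gauss \<psi> \<omega> m = gauss \<psi> \<omega> m'"
  unfolding gauss_def by (intro sum.cong refl arg_cong2[of _ _ _ _ "(*)"] omega_powi_mod) auto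

section \<open>Orthogonality and reflection of Gauss sums\<close>

lemma sum_psi_mult: "(\<Sum>y\<in>UNIV. \<psi> (a * y)) = (if a = 0 then of_nat q else 0)"
proof (cases "a = 0")
  case False
  obtain c where c: "\<psi> c \<noteq> 1" using psi by (auto simp: nontrivial_add_char_def)
  \<comment> \<open>This translation multiplies the sum by \<open>\<psi> c\<close>, which is not 1,
    so the sum vanishes.\<close>
  have "(\<Sum>y\<in>UNIV. \<psi> (a * y)) = (\<Sum>y\<in>UNIV. \<psi> (a * (y + c / a)))"
    by (rule sum.reindex_bij_witness[of _ "\<lambda>y. y + c / a" "\<lambda>y. y - c / a"]) auto
  also have "\<dots> = \<psi> c * (\<Sum>y\<in>UNIV. \<psi> (a * y))"
    using False by (simp add: distrib_left psi_add sum_distrib_left mult.commute)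
  finally show ?thesis using c False by auto
qed (simp add: q_def)

lemma sum_psi_nonzero: "(\<Sum>y\<in>UNIV - {0}. \<psi> (a * y)) = (if a = 0 then of_nat q else 0) - 1"
  using sum.remove[of UNIV "0::'a" "\<lambda>y. \<psi> (a * y)"] by (simp add: sum_psi_mult)

lemma gauss_0: "gauss \<psi> \<omega> 0 = -1"
  using sum_psi_nonzero[of 1] by (simp add: gauss_def)

lemma omega_powi_eq_1_imp_dvd:
  assumes "\<And>x. x \<noteq> 0 \<Longrightarrow> \<omega> x powi m = 1"
  shows "int n dvd m"
proof (rule ccontr)
  assume "\<not> int n dvd m"
  define k where "k = nat (m mod int n)"
  have k: "int k = m mod int n" using n_pos by (simp add: k_def)
  have "int k < int n" unfolding k using n_pos by (intro pos_mod_bound) auto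
  moreover have "int k \<noteq> 0" unfolding k using \<open>\<not> int n dvd m\<close> by (simp add: dvd_eq_mod_eq_0)
  ultimately have "0 < k" "k < n" by auto
  obtain x where x: "x \<noteq> 0" "\<omega> x ^ k \<noteq> 1"
    using omega \<open>0 < k\<close> \<open>k < n\<close> unfolding generating_char_def n_def q_def by blast
  have "\<omega> x powi int k = \<omega> x powi m" using x k by (intro omega_powi_mod) auto
  thus False using assms[of x] x by simp
qed

lemma sum_omega_powi:
  assumes "\<not> int n dvd m"
  shows "(\<Sum>x\<in>UNIV - {0}. \<omega> x powi m) = 0"
proof -
  obtain c where c: "c \<noteq> 0" "\<omega> c powi m \<noteq> 1" using omega_powi_eq_1_imp_dvd assms by blast
  have "(\<Sum>x\<in>UNIV - {0}. \<omega> x powi m) = (\<Sum>x\<in>UNIV - {0}. \<omega> (c * x) powi m)"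
    by (rule sum.reindex_bij_witness[of _ "\<lambda>x. c * x" "\<lambda>x. x / c"]) (use c in auto)
  also have "\<dots> = \<omega> c powi m * (\<Sum>x\<in>UNIV - {0}. \<omega> x powi m)"
    using c by (simp add: omega_powi_mult sum_distrib_left)
  finally show ?thesis using c by auto
qed

text \<open>Substituting \<open>x = u * y\<close> cancels the character of \<open>y\<close>. The sum
  over \<open>y\<close> is then \<open>q - 1\<close> for \<open>u = -1\<close> and \<open>-1\<close>
  otherwise; the terms \<open>-1\<close> add up to zero by orthogonality of
  \<open>\<omega> powi m\<close>.\<close>

lemma gauss_mult_gauss_uminus:
  assumes "\<not> int n dvd m"
  shows "gauss \<psi> \<omega> m * gauss \<psi> \<omega> (-m) = \<omega> (-1) powi m * of_nat q"
proof -
  have "gauss \<psi> \<omega> m * gauss \<psi> \<omega> (-m) =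
      (\<Sum>y\<in>UNIV-{0}. \<Sum>x\<in>UNIV-{0}. \<omega> x powi m * \<psi> x * (\<omega> y powi (-m) * \<psi> y))"
    unfolding gauss_def sum_product by (rule sum.swap)
  also have "\<dots> = (\<Sum>y\<in>UNIV-{0}. \<Sum>u\<in>UNIV-{0}. \<omega> u powi m * \<psi> ((u + 1) * y))"
  proof (rule sum.cong[OF refl])
    fix y :: 'a assume y: "y \<in> UNIV - {0}"
    show "(\<Sum>x\<in>UNIV-{0}. \<omega> x powi m * \<psi> x * (\<omega> y powi (-m) * \<psi> y))
        = (\<Sum>u\<in>UNIV-{0}. \<omega> u powi m * \<psi> ((u + 1) * y))"
    proof (rule sum.reindex_bij_witness[of _ "\<lambda>u. u * y" "\<lambda>x. x / y"], goal_cases)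
      case (5 x)
      have "\<omega> x powi m = \<omega> (x / y) powi m * \<omega> y powi m"
        using omega_powi_mult[of "x / y" y m] y 5 by simp
      moreover have "\<psi> x * \<psi> y = \<psi> ((x / y + 1) * y)"
        using y by (simp add: psi_add distrib_right)
      moreover have "\<omega> y powi m * \<omega> y powi (-m) = 1"
        using omega_nz[of y] y by (simp add: power_int_minus)
      ultimately show ?case by (metis (no_types, lifting) mult.assoc mult.commute mult.left_neutral)
    qed (use y in auto)
  qed
  also have "\<dots> = (\<Sum>u\<in>UNIV-{0}. \<omega> u powi m * ((if u + 1 = 0 then of_nat q else 0) - 1))"
    by (subst sum.swap) (simp add: sum_distrib_left[symmetric] sum_psi_nonzero)
  also have "\<dots> = (\<Sum>u\<in>UNIV-{0}. if u = -1 then \<omega> u powi m * of_nat q else 0) - (\<Sum>u\<in>UNIV-{0}. \<omega> u powi m)"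
    unfolding sum_subtractf[symmetric] by (intro sum.cong) (auto simp: algebra_simps eq_neg_iff_add_eq_0)
  also have "\<dots> = \<omega> (-1) powi m * of_nat q"
    by (simp add: sum_omega_powi[OF assms] sum.delta)
  finally show ?thesis .
qed

lemma gauss_nz: "gauss \<psi> \<omega> m \<noteq> 0"
proof (cases "int n dvd m")
  case True
  hence "gauss \<psi> \<omega> m = gauss \<psi> \<omega> 0" by (intro gauss_mod) auto
  thus ?thesis by (simp add: gauss_0)
next
  case False
  have "gauss \<psi> \<omega> m * gauss \<psi> \<omega> (-m) \<noteq> 0"
    using gauss_mult_gauss_uminus[OF False] omega_nz[of "-1"] q_eq by (simp del: of_nat_Suc)
  thus ?thesis by auto
qed

section \<open>Characteristic and roots of unity of the field\<close>

lemma of_nat_q: "of_nat q = (0::'a)"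
proof -
  \<comment> \<open>Translation by 1 permutes the field, and it adds \<open>q\<close> to the sum of
    all elements.\<close>
  have "(\<Sum>x\<in>UNIV. x) = (\<Sum>x\<in>UNIV. x + (1::'a))"
    by (rule sum.reindex_bij_witness[of _ "\<lambda>x. x + 1" "\<lambda>x. x - 1"]) auto
  thus ?thesis by (simp add: sum.distrib q_def)
qed

text \<open>If a divisor of \<open>n\<close> vanished in the field, so would \<open>n\<close>, and
  then \<open>q = n + 1\<close> could not vanish.\<close>

lemma of_nat_dvd_n_nz:
  assumes "N dvd n"
  shows "of_nat N \<noteq> (0::'a)"
proof
  assume "of_nat N = (0::'a)"
  hence "of_nat n = (0::'a)" using assms by (auto elim!: dvdE)
  thus False using of_nat_q by (simp add: q_eq)
qed

text \<open>\<open>\<omega>\<close> identifies the nonzero field elements with the complex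
  \<open>n\<close>-th roots of unity, where the count is known.\<close>

lemma card_roots_of_unity:
  assumes "N dvd n"
  shows "card {x::'a. x ^ N = 1} = N"
proof -
  have N: "N > 0" using assms n_pos by (auto intro: Nat.gr0I)
  have nz: "x \<noteq> 0" if "x ^ N = 1" for x :: 'a using that N by (auto simp: power_0_left)
  have "\<omega> ` {x. x ^ N = 1} = {z. z ^ N = 1}"
  proof (intro equalityI subsetI)
    fix z :: complex assume "z \<in> {z. z ^ N = 1}"
    hence z: "z ^ N = 1" by simp
    obtain l where "n = N * l" using assms by (auto elim: dvdE)
    hence "z ^ n = 1" using z by (metis power_mult power_one)
    then obtain x where x: "z = \<omega> x" "x \<noteq> 0" using omega_image by blast
    hence "\<omega> (x ^ N) = 1" using z by (simp add: omega_power)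
    hence "x ^ N = 1" using x omega_eq_1_iff[of "x ^ N"] by simp
    thus "z \<in> \<omega> ` {x. x ^ N = 1}" using x by auto
  next
    fix z assume "z \<in> \<omega> ` {x. x ^ N = 1}"
    then obtain x where x: "z = \<omega> x" "x ^ N = 1" by auto
    thus "z \<in> {z. z ^ N = 1}" using omega_power[OF nz[OF x(2)], of N] by simp
  qed
  moreover have "inj_on \<omega> {x. x ^ N = 1}"
    by (rule inj_on_subset[OF omega_inj]) (auto dest: nz)
  ultimately have "card {x::'a. x ^ N = 1} = card {z::complex. z ^ N = 1}"
    by (metis card_image)
  thus ?thesis using card_roots_unity_eq[of N] N by simp
qed

text \<open>The characters summed are those of order dividing \<open>N\<close>, and
  \<open>u ^ N' = 1\<close> says that \<open>u\<close> is an \<open>N\<close>-th power; the sum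
  detects this.\<close>

lemma sum_char_order:
  assumes N: "N * N' = n" and u: "u \<noteq> 0"
  shows "(\<Sum>j<N. \<omega> u powi (int j * int N')) = (if u ^ N' = 1 then of_nat N else 0)"
proof -
  define r where "r = \<omega> (u ^ N')"
  have r: "\<omega> u powi (int j * int N') = r ^ j" for j
    using u by (simp add: r_def omega_power power_mult mult.commute[of _ "int N'"] power_int_mult)
  have "r ^ N = 1" using pow_n[OF u] u N by (simp add: r_def mult.commute flip: omega_power power_mult)
  moreover have "r = 1 \<longleftrightarrow> u ^ N' = 1" using u by (simp add: r_def omega_eq_1_iff)
  ultimately show ?thesis
    by (auto simp: r sum_gp_strict)
qed

section \<open>Stable multisets in the algebraic closure\<close>

definition frob :: "'a alg_closure \<Rightarrow> 'a alg_closure" where "frob z = z ^ q"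

text \<open>Since \<open>q\<close> vanishes in the field, the characteristic divides
  \<open>p ^ k\<close>, hence equals \<open>p\<close>; raising to the power \<open>q\<close> is then
  an iterated freshman's dream.\<close>

lemma frob_add: "frob (x + y) = frob x + frob y"
proof -
  obtain p k where p: "prime p" "0 < k" "q = p ^ k" using primepow by (auto simp: q_def)
  have dvd: "CHAR('a) dvd p ^ k" using of_nat_q p(3) by (metis of_nat_eq_0_iff_char_dvd)
  hence "CHAR('a) \<noteq> 0" using p by (auto intro!: Nat.gr0I)
  hence "prime CHAR('a)" by (intro prime_CHAR_semidom) auto
  moreover from this have "CHAR('a) = p"
    using dvd p(1) by (metis prime_dvd_power_nat primes_dvd_imp_eq)
  ultimately show ?thesis unfolding frob_def
    by (intro freshmans_dream'[where n = k]) (auto simp: p)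
qed

lemma frob_mult: "frob (x * y) = frob x * frob y"
  and frob_power: "frob (x ^ k) = frob x ^ k"
  and frob_0 [simp]: "frob 0 = 0" and frob_1 [simp]: "frob 1 = 1"
  by (simp_all add: frob_def power_mult_distrib power_0_left q_eq flip: power_mult)
     (simp add: mult.commute)

lemma frob_to_ac [simp]: "frob (to_ac x) = to_ac x"
proof (cases "x = 0")
  case False
  thus ?thesis using pow_n[of x] by (simp add: frob_def q_eq flip: to_ac_power)
qed simp

lemma frob_uminus: "frob (- x) = - frob x"
  using frob_add[of x "-x"] by (simp add: eq_neg_iff_add_eq_0 add.commute)

lemma inj_frob: "inj frob"
proof (rule injI)
  fix x y assume "frob x = frob y"
  hence "frob (x - y) = 0" using frob_add[of x "-y"] by (simp add: frob_uminus)
  thus "x = y" by (auto simp: frob_def q_eq)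
qed

lemma funpow_frob: "(frob ^^ k) z = z ^ (q ^ k)"
  by (induction k) (auto simp: frob_def mult.commute simp flip: power_mult)

lemma finite_roots_power_eq_self:
  assumes "1 < k"
  shows "finite {z::'a alg_closure. z ^ k = z}" "card {z::'a alg_closure. z ^ k = z} \<le> k"
proof -
  define P :: "'a alg_closure poly" where "P = monom 1 k - monom 1 1"
  have "coeff P k = 1" using assms by (simp add: P_def)
  hence P: "P \<noteq> 0" by auto
  have deg: "degree P \<le> k" unfolding P_def using assms
    by (intro degree_diff_le order.trans[OF degree_monom_le]) auto
  have eq: "{z. z ^ k = z} = {z. poly P z = 0}" by (auto simp: P_def poly_monom)
  show "finite {z::'a alg_closure. z ^ k = z}" unfolding eq by (rule poly_roots_finite[OF P])
  show "card {z::'a alg_closure. z ^ k = z} \<le> k" unfolding eq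
    using card_poly_roots_bound[OF P] deg by simp
qed

text \<open>The embedded field supplies \<open>q\<close> roots of \<open>X ^ q - X\<close>, which
  has at most \<open>q\<close>.\<close>

lemma frob_eq_self_iff: "frob z = z \<longleftrightarrow> z \<in> range to_ac"
proof -
  have q1: "1 < q" using n_pos q_eq by simp
  have "range to_ac = {z::'a alg_closure. z ^ q = z}"
  proof (rule card_seteq)
    show "range to_ac \<subseteq> {z::'a alg_closure. z ^ q = z}"
      using frob_to_ac unfolding frob_def by blast
    have "card (range (to_ac :: 'a \<Rightarrow> _)) = q" by (simp add: card_image[OF inj_to_ac] q_def)
    thus "card {z::'a alg_closure. z ^ q = z} \<le> card (range (to_ac :: 'a \<Rightarrow> _))"
      using finite_roots_power_eq_self[OF q1] by simp
  qed (use finite_roots_power_eq_self[OF q1] in auto)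
  thus ?thesis by (auto simp: frob_def)
qed

abbreviation stable :: "'a alg_closure multiset \<Rightarrow> bool" where
  "stable \<equiv> stable_mset frob (- {0})"

text \<open>Frobenius-stable multisets of nonzero elements are the root multisets of the monic
  polynomials \<open>f\<close> over the finite field with \<open>f(0) \<noteq> 0\<close>, so \<open>mset_norm\<close> and \<open>mset_trace\<close> take values in the
  finite field; \<open>of_ac\<close> is only meaningful on such multisets.\<close>
definition mset_norm :: "'a alg_closure multiset \<Rightarrow> 'a" where "mset_norm M = of_ac (prod_mset M)"
definition mset_trace :: "'a alg_closure multiset \<Rightarrow> 'a" where "mset_trace M = of_ac (sum_mset M)"

lemma frob_prod_mset: "frob (prod_mset M) = prod_mset (image_mset frob M)"
  by (induction M) (auto simp: frob_mult)

lemma frob_sum_mset: "frob (sum_mset M) = sum_mset (image_mset frob M)"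
  by (induction M) (auto simp: frob_add)

text \<open>Frobenius permutes \<open>M\<close> and therefore fixes its product, which descends to
  the base field.\<close>

lemma to_ac_mset_norm: "image_mset frob M = M \<Longrightarrow> to_ac (mset_norm M) = prod_mset M"
  unfolding mset_norm_def by (rule to_ac_of_ac) (metis frob_eq_self_iff frob_prod_mset)

lemma to_ac_mset_trace: "image_mset frob M = M \<Longrightarrow> to_ac (mset_trace M) = sum_mset M"
  unfolding mset_trace_def by (rule to_ac_of_ac) (metis frob_eq_self_iff frob_sum_mset)

lemma stable_power: "stable M \<Longrightarrow> stable (image_mset (\<lambda>z. z ^ k) M)"
proof -
  assume M: "stable M"
  have "image_mset frob (image_mset (\<lambda>z. z ^ k) M) = image_mset (\<lambda>z. z ^ k) (image_mset frob M)"
    by (simp add: image_mset.compositionality comp_def frob_power)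
  thus ?thesis using M by (auto simp: stable_mset_def)
qed

lemma mset_norm_add:
  assumes "stable M" "stable M'"
  shows "mset_norm (M + M') = mset_norm M * mset_norm M'"
proof -
  have "to_ac (mset_norm (M + M')) = to_ac (mset_norm M * mset_norm M')"
    using assms to_ac_mset_norm[of M] to_ac_mset_norm[of M'] to_ac_mset_norm[of "M + M'"] by (simp add: stable_mset_def)
  thus ?thesis by (simp only: to_ac_eq_iff)
qed

lemma mset_trace_add:
  assumes "stable M" "stable M'"
  shows "mset_trace (M + M') = mset_trace M + mset_trace M'"
proof -
  have "to_ac (mset_trace (M + M')) = to_ac (mset_trace M + mset_trace M')"
    using assms to_ac_mset_trace[of M] to_ac_mset_trace[of M'] to_ac_mset_trace[of "M + M'"] by (simp add: stable_mset_def)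
  thus ?thesis by (simp only: to_ac_eq_iff)
qed

lemma mset_norm_nz: "stable M \<Longrightarrow> mset_norm M \<noteq> 0"
proof
  assume M: "stable M" and "mset_norm M = 0"
  hence "prod_mset M = 0" using to_ac_mset_norm[of M] by (simp add: stable_mset_def)
  thus False using M by (auto simp: stable_mset_def)
qed

section \<open>Weights, their trace sums and their L-series\<close>

definition weight :: "int \<Rightarrow> 'a alg_closure multiset \<Rightarrow> complex" where
  "weight m M = \<omega> (mset_norm M) powi m * \<psi> (mset_trace M)"

text \<open>Pullback of \<open>weight m\<close> along the endomorphism
  \<open>z \<mapsto> z ^ N\<close> of the multiplicative group.\<close>

definition weight_pow :: "nat \<Rightarrow> int \<Rightarrow> 'a alg_closure multiset \<Rightarrow> complex" where
  "weight_pow N m M = weight m (image_mset (\<lambda>z. z ^ N) M)"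

lemma weight_add: "stable M \<Longrightarrow> stable M' \<Longrightarrow> weight m (M + M') = weight m M * weight m M'"
  by (simp add: weight_def mset_norm_add mset_trace_add omega_powi_mult mset_norm_nz psi_add)

lemma weight_empty: "weight m {#} = 1"
proof -
  have "mset_norm {#} = 1" by (simp add: mset_norm_def of_ac_eqI)
  moreover have "mset_trace {#} = 0" by (simp add: mset_trace_def of_ac_eqI)
  ultimately show ?thesis by (simp add: weight_def)
qed

lemma frobenius_weightI:
  assumes "w {#} = 1" "\<And>M M'. stable M \<Longrightarrow> stable M' \<Longrightarrow> w (M + M') = w M * w M'"
  shows "frobenius_weight frob (- {0}) w"
proof
  show "finite {z \<in> - {0}. (frob ^^ k) z = z}" if "0 < k" for k
  proof -
    have "1 < q ^ k" using n_pos q_eq that by (intro one_less_power) auto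
    thus ?thesis using finite_roots_power_eq_self(1)[of "q ^ k"] by (simp add: funpow_frob)
  qed
qed (use assms inj_frob in \<open>auto simp: frob_def\<close>)

lemma frobenius_weight_weight: "frobenius_weight frob (- {0}) (weight m)"
  by (rule frobenius_weightI) (auto simp: weight_empty weight_add)

lemma frobenius_weight_weight_pow: "frobenius_weight frob (- {0}) (weight_pow N m)"
  by (rule frobenius_weightI) (auto simp: weight_pow_def weight_empty weight_add stable_power)

abbreviation "frob_fixpts \<equiv> frobenius_weight.fixpts frob (- {0})"

lemma frob_fixpts_eq: "frob_fixpts k = {z. z \<noteq> 0 \<and> z ^ (q ^ k) = z}"
  using frobenius_weight.fixpts_def[OF frobenius_weight_weight[of 0]] by (auto simp: funpow_frob)

lemma finite_frob_fixpts: "0 < k \<Longrightarrow> finite (frob_fixpts k)"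
  using frobenius_weight.finite_fixpts[OF frobenius_weight_weight[of 0]] by blast

lemma stable_orbit: "z \<in> frob_fixpts k \<Longrightarrow> stable (orbit_mset frob k z)"
  using frobenius_weight.stable_orbit[OF frobenius_weight_weight[of 0]] by blast

lemma image_power_orbit: "image_mset (\<lambda>z. z ^ N) (orbit_mset frob k z) = orbit_mset frob k (z ^ N)"
  by (simp add: orbit_mset_def image_mset.compositionality comp_def funpow_frob mult.commute flip: power_mult)

text \<open>The exponent is that of the norm from the field with \<open>q ^ k\<close>
  elements.\<close>

lemma prod_mset_orbit: "prod_mset (orbit_mset frob k z) = z ^ (\<Sum>i<k. q ^ i)"
  by (simp add: orbit_mset_def funpow_frob power_sum flip: prod_unfold_prod_mset)

text \<open>Multiplying one root by the \<open>N\<close> roots of unity of the base field gives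
  \<open>N\<close> roots; the degree of \<open>X ^ N - x\<close> excludes further ones.\<close>

lemma card_nth_roots:
  assumes "N dvd n" "x \<noteq> 0"
  shows "card {z::'a alg_closure. z ^ N = x} = N"
proof -
  have N: "N > 0" using assms(1) n_pos by (auto intro: Nat.gr0I)
  obtain y where y: "y ^ N = x" using nth_root_exists[OF N] by blast
  have y0: "y \<noteq> 0" using y assms(2) N by (auto simp: power_0_left)
  let ?U = "(\<lambda>\<zeta>. to_ac \<zeta> * y) ` {\<zeta>::'a. \<zeta> ^ N = 1}"
  have sub: "?U \<subseteq> {z. z ^ N = x}"
    using y by (auto simp: power_mult_distrib simp flip: to_ac_power)
  have cU: "card ?U = N"
    using y0 by (subst card_image) (auto simp: inj_on_def card_roots_of_unity assms(1))
  define P :: "'a alg_closure poly" where "P = monom 1 N - [:x:]"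
  have "coeff P N = 1" using N by (simp add: P_def coeff_pCons split: nat.splits)
  hence P: "P \<noteq> 0" by auto
  have deg: "degree P \<le> N" unfolding P_def
    by (intro degree_diff_le order.trans[OF degree_monom_le]) auto
  have eq: "{z. z ^ N = x} = {z. poly P z = 0}" by (auto simp: P_def poly_monom)
  have "card {z. z ^ N = x} \<le> N"
    unfolding eq using card_poly_roots_bound[OF P] deg by simp
  moreover have "N \<le> card {z. z ^ N = x}"
    using card_mono[OF _ sub] cU poly_roots_finite[OF P] unfolding eq by simp
  ultimately show ?thesis by simp
qed

text \<open>A root \<open>z\<close> of \<open>z ^ N = x\<close> lies in the degree \<open>k\<close>
  extension iff \<open>z ^ (q ^ k - 1) = 1\<close>. Because \<open>q ^ k - 1 = N * N' * e\<close>,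
  this says \<open>(x ^ e) ^ N' = 1\<close>, where \<open>x ^ e\<close> is the norm of
  \<open>x\<close>. So either all \<open>N\<close> roots lie there or none does.\<close>

lemma card_frob_fixpts_roots:
  assumes N: "N * N' = n" and k: "0 < k" and x: "x \<in> frob_fixpts k"
  shows "card {z\<in>frob_fixpts k. z ^ N = x} = (if mset_norm (orbit_mset frob k x) ^ N' = 1 then N else 0)"
proof -
  define e where "e = (\<Sum>i<k. q ^ i)"
  have e: "n * e + 1 = q ^ k"
    unfolding e_def q_eq by (induction k) (auto simp: algebra_simps)
  have x0: "x \<noteq> 0" using x by (simp add: frob_fixpts_eq)
  have mset_norm: "to_ac (mset_norm (orbit_mset frob k x)) = x ^ e"
    using to_ac_mset_norm[of "orbit_mset frob k x"] stable_orbit[OF x]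
    by (simp add: prod_mset_orbit stable_mset_def e_def)
  have N0: "N > 0" using N n_pos by (auto intro: Nat.gr0I)
  have "z \<in> frob_fixpts k \<longleftrightarrow> mset_norm (orbit_mset frob k x) ^ N' = 1" if z: "z ^ N = x" for z
  proof -
    have z0: "z \<noteq> 0" using z x0 N0 by (auto simp: power_0_left)
    have "z \<in> frob_fixpts k \<longleftrightarrow> z ^ (n * e) * z = z" using z0 by (simp add: frob_fixpts_eq flip: e)
    also have "\<dots> \<longleftrightarrow> z ^ (N * (e * N')) = 1"
      using z0 N by (simp add: mult.commute mult.left_commute flip: N)
    also have "\<dots> \<longleftrightarrow> to_ac (mset_norm (orbit_mset frob k x) ^ N') = 1"
      by (simp only: power_mult z to_ac_power mset_norm)
    finally show ?thesis by (simp del: to_ac_power flip: to_ac_1)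
  qed
  hence "{z\<in>frob_fixpts k. z ^ N = x} = (if mset_norm (orbit_mset frob k x) ^ N' = 1 then {z. z ^ N = x} else {})"
    by auto
  moreover have "N dvd n" using N by (metis dvd_triv_left)
  ultimately show ?thesis using card_nth_roots[of N x] x0 by auto
qed

abbreviation "trace_sums \<equiv> frobenius_weight.trace_sum frob (- {0})"
abbreviation "L_coeffs \<equiv> frobenius_weight.L_coeff frob (- {0})"

lemma trace_sums_eq: "frobenius_weight frob (- {0}) w \<Longrightarrow> trace_sums w k = (if k = 0 then 0 else \<Sum>z\<in>frob_fixpts k. w (orbit_mset frob k z))"
  by (rule frobenius_weight.trace_sum_def)

lemma weight_shift: "stable M \<Longrightarrow> weight (m + l) M = weight m M * \<omega> (mset_norm M) powi l"
  by (simp add: weight_def power_int_add omega_nz mset_norm_nz)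

text \<open>Group the points \<open>z\<close> by \<open>x = z ^ N\<close>. The number of roots over
  \<open>x\<close> is the sum of all characters of order dividing \<open>N\<close>, evaluated at the
  norm of \<open>x\<close>; each of them shifts the exponent \<open>m\<close> by a multiple of
  \<open>N'\<close>.\<close>

lemma trace_sums_weight_pow:
  assumes N: "N * N' = n"
  shows "trace_sums (weight_pow N m) k = (\<Sum>j<N. trace_sums (weight (m + int j * int N')) k)"
proof (cases "k = 0")
  case False
  hence k: "0 < k" by simp
  have maps: "z ^ N \<in> frob_fixpts k" if "z \<in> frob_fixpts k" for z
    using that by (auto simp: frob_fixpts_eq simp flip: power_mult) (metis mult.commute power_mult)
  have "trace_sums (weight_pow N m) k = (\<Sum>z\<in>frob_fixpts k. weight m (orbit_mset frob k (z ^ N)))"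
    using k by (simp add: trace_sums_eq[OF frobenius_weight_weight_pow] weight_pow_def image_power_orbit)
  also have "\<dots> = (\<Sum>x\<in>frob_fixpts k. \<Sum>z\<in>{z\<in>frob_fixpts k. z ^ N = x}. weight m (orbit_mset frob k (z ^ N)))"
    by (rule sum.group[symmetric]) (use finite_frob_fixpts[OF k] maps in auto)
  also have "\<dots> = (\<Sum>x\<in>frob_fixpts k. weight m (orbit_mset frob k x) * of_nat (card {z\<in>frob_fixpts k. z ^ N = x}))"
    by (intro sum.cong refl) simp
  also have "\<dots> = (\<Sum>x\<in>frob_fixpts k. \<Sum>j<N. weight (m + int j * int N') (orbit_mset frob k x))"
  proof (intro sum.cong refl)
    fix x assume x: "x \<in> frob_fixpts k"
    note st = stable_orbit[OF x]
    have "of_nat (card {z\<in>frob_fixpts k. z ^ N = x}) = (\<Sum>j<N. \<omega> (mset_norm (orbit_mset frob k x)) powi (int j * int N'))"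
      unfolding card_frob_fixpts_roots[OF N k x] sum_char_order[OF N mset_norm_nz[OF st]] by simp
    thus "weight m (orbit_mset frob k x) * of_nat (card {z\<in>frob_fixpts k. z ^ N = x})
      = (\<Sum>j<N. weight (m + int j * int N') (orbit_mset frob k x))"
      by (simp add: weight_shift[OF st] sum_distrib_left)
  qed
  also have "\<dots> = (\<Sum>j<N. trace_sums (weight (m + int j * int N')) k)"
    by (subst sum.swap) (use k in \<open>simp add: trace_sums_eq[OF frobenius_weight_weight]\<close>)
  finally show ?thesis .
qed (simp add: trace_sums_eq frobenius_weight_weight frobenius_weight_weight_pow)

text \<open>Both sides have constant term 1 and, by \<open>trace_sums_weight_pow\<close>, the same
  logarithmic derivative.\<close>

lemma L_series_weight_pow:
  assumes N: "N * N' = n"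
  shows "Abs_fps (L_coeffs (weight_pow N m)) = (\<Prod>j<N. Abs_fps (L_coeffs (weight (m + int j * int N'))))"
proof (rule fps_log_deriv_unique)
  let ?S = "Abs_fps (trace_sums (weight_pow N m))"
  show "fps_X * fps_deriv (Abs_fps (L_coeffs (weight_pow N m))) = ?S * Abs_fps (L_coeffs (weight_pow N m))"
    by (rule frobenius_weight.L_series_deriv[OF frobenius_weight_weight_pow])
  have "fps_X * fps_deriv (\<Prod>j<N. Abs_fps (L_coeffs (weight (m + int j * int N')))) =
    (\<Sum>j<N. Abs_fps (trace_sums (weight (m + int j * int N')))) * (\<Prod>j<N. Abs_fps (L_coeffs (weight (m + int j * int N'))))"
    by (rule fps_log_deriv_prod) (auto intro: frobenius_weight.L_series_deriv[OF frobenius_weight_weight])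
  also have "(\<Sum>j<N. Abs_fps (trace_sums (weight (m + int j * int N')))) = ?S"
    by (rule fps_ext) (simp add: fps_sum_nth trace_sums_weight_pow[OF N])
  finally show "fps_X * fps_deriv (\<Prod>j<N. Abs_fps (L_coeffs (weight (m + int j * int N')))) =
      ?S * (\<Prod>j<N. Abs_fps (L_coeffs (weight (m + int j * int N'))))" .
  show "?S $ 0 = 0" by (simp add: trace_sums_eq frobenius_weight_weight_pow)
  show "Abs_fps (L_coeffs (weight_pow N m)) $ 0 = (\<Prod>j<N. Abs_fps (L_coeffs (weight (m + int j * int N')))) $ 0"
    by (simp add: fps_nth_0_prod frobenius_weight.L_coeff_0 frobenius_weight_weight frobenius_weight_weight_pow)
qed

end

section \<open>Root multisets and the Hasse--Davenport product formula\<close>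

lemma map_poly_mult_hom:
  fixes h :: "'b::comm_semiring_0 \<Rightarrow> 'c::comm_semiring_0"
  assumes "h 0 = 0" "\<And>x y. h (x + y) = h x + h y" "\<And>x y. h (x * y) = h x * h y"
  shows "map_poly h (p * q) = map_poly h p * map_poly h q"
proof (rule poly_eqI)
  fix n
  have "h (sum f A) = (\<Sum>i\<in>A. h (f i))" for f and A :: "nat set"
    by (induction A rule: infinite_finite_induct) (auto simp: assms)
  thus "coeff (map_poly h (p * q)) n = coeff (map_poly h p * map_poly h q) n"
    by (simp add: coeff_map_poly coeff_mult assms)
qed

definition lin_prod :: "'b::idom multiset \<Rightarrow> 'b poly" where
  "lin_prod M = (\<Prod>z\<in>#M. [:-z, 1:])"

lemma lin_prod_empty [simp]: "lin_prod {#} = 1"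
  and lin_prod_add [simp]: "lin_prod (add_mset z M) = [:-z, 1:] * lin_prod M"
  by (simp_all add: lin_prod_def)

lemma lin_prod_nz [simp]: "lin_prod M \<noteq> 0"
  by (induction M) (auto simp del: mult_pCons_left)

lemma proots_lin_prod [simp]: "proots (lin_prod M) = M"
  by (induction M) (auto simp: proots_mult simp del: mult_pCons_left)

lemma degree_lin_prod [simp]: "degree (lin_prod M) = size M"
  by (induction M) (auto simp: degree_mult_eq simp del: mult_pCons_left)

lemma lead_coeff_lin_prod [simp]: "lead_coeff (lin_prod M) = 1"
  by (induction M) (auto simp: lead_coeff_mult simp del: mult_pCons_left)

lemma coeff_0_lin_prod: "coeff (lin_prod M) 0 = (-1) ^ size M * prod_mset M"
  by (induction M) (auto simp: mult_ac)

lemma lin_prod_proots: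
  fixes p :: "'b::alg_closed_field poly"
  assumes "lead_coeff p = 1"
  shows "lin_prod (proots p) = p"
proof -
  have "p \<noteq> 0" using assms by auto
  then obtain A where "p = lin_prod A"
    using alg_closed_imp_factorization[of p] assms by (auto simp: lin_prod_def)
  thus ?thesis by simp
qed

section \<open>Power sums and Newton's identities\<close>

definition power_sum :: "nat \<Rightarrow> 'b::comm_ring_1 multiset \<Rightarrow> 'b" where
  "power_sum k M = (\<Sum>z\<in>#M. z ^ k)"

lemma power_sum_simps [simp]: "power_sum k {#} = 0" "power_sum k (add_mset z M) = z ^ k + power_sum k M"
  by (simp_all add: power_sum_def)

text \<open>The reflected polynomial is the product of the factors \<open>1 - z T\<close> over the
  roots \<open>z\<close>. Its logarithmic derivative is minus the sum of the
  \<open>z / (1 - z T)\<close>, whose expansion gives the power sums.\<close>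

lemma newton_fps:
  fixes M :: "'b::field multiset"
  defines "P \<equiv> fps_of_poly (reflect_poly (lin_prod M))"
  shows "fps_deriv P = - P * Abs_fps (\<lambda>k. power_sum (Suc k) M)"
  unfolding P_def
proof (induction M)
  case empty
  have "Abs_fps (\<lambda>k. power_sum (Suc k) ({#} :: 'b multiset)) = 0" by (rule fps_ext) simp
  thus ?case by simp
next
  case (add z M)
  define P where "P = fps_of_poly (reflect_poly (lin_prod M))"
  define S where "S = Abs_fps (\<lambda>k. power_sum (Suc k) M)"
  define G where "G = Abs_fps (\<lambda>k. z ^ Suc k)"
  have S: "Abs_fps (\<lambda>k. power_sum (Suc k) (add_mset z M)) = G + S"
    by (rule fps_ext) (simp add: G_def S_def)
  have "reflect_poly [:-z, 1:] = [:1, -z:]" by (simp add: reflect_poly_def)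
  hence P: "fps_of_poly (reflect_poly (lin_prod (add_mset z M))) = (1 - fps_const z * fps_X) * P"
    by (simp add: P_def reflect_poly_mult fps_of_poly_mult fps_of_poly_pCons del: mult_pCons_left)
  have G: "(1 - fps_const z * fps_X) * G = fps_const z"
  proof (rule fps_ext)
    fix k show "((1 - fps_const z * fps_X) * G) $ k = fps_const z $ k"
      by (cases k) (auto simp: G_def algebra_simps)
  qed
  have "fps_deriv ((1 - fps_const z * fps_X) * P) = - fps_const z * P + (1 - fps_const z * fps_X) * (- P * S)"
    using add.IH by (simp add: P_def S_def)
  also have "\<dots> = - ((1 - fps_const z * fps_X) * G) * P + (1 - fps_const z * fps_X) * (- P * S)"
    by (simp only: G)
  also have "\<dots> = - ((1 - fps_const z * fps_X) * P) * (G + S)"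
    by (simp add: algebra_simps)
  finally show ?case unfolding P S .
qed

text \<open>Compare coefficients at \<open>T ^ (k - 1)\<close> in \<open>newton_fps\<close>. Keeping
  the factor \<open>of_nat k\<close> makes the identity valid in every characteristic.\<close>

lemma newton_identity:
  fixes M :: "'b::field multiset"
  assumes "0 < k" "k \<le> size M"
  shows "of_nat k * coeff (lin_prod M) (size M - k) = - (\<Sum>i<k. coeff (lin_prod M) (size M - i) * power_sum (k - i) M)"
proof -
  define P where "P = fps_of_poly (reflect_poly (lin_prod M))"
  have nth: "P $ i = coeff (lin_prod M) (size M - i)" if "i \<le> size M" for i
    using that by (simp add: P_def coeff_reflect_poly)
  obtain l where l: "k = Suc l" using assms(1) by (cases k) auto
  have "fps_deriv P $ l = (- P * Abs_fps (\<lambda>k. power_sum (Suc k) M)) $ l"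
    unfolding P_def by (subst newton_fps) simp
  hence "of_nat k * P $ k = - (\<Sum>i=0..l. P $ i * power_sum (Suc (l - i)) M)"
    by (simp add: fps_mult_nth sum_negf l)
  also have "(\<Sum>i=0..l. P $ i * power_sum (Suc (l - i)) M) = (\<Sum>i<k. coeff (lin_prod M) (size M - i) * power_sum (k - i) M)"
    by (rule sum.cong) (use assms in \<open>auto simp: l nth Suc_diff_le\<close>)
  finally show ?thesis using assms by (simp add: nth)
qed

lemma coeff_lin_prod_sum: "0 < size M \<Longrightarrow> coeff (lin_prod M) (size M - 1) = - sum_mset (M :: 'b::field multiset)"
  using newton_identity[of 1 M] by (simp add: power_sum_def lead_coeff_lin_prod[unfolded degree_lin_prod])

text \<open>The identities below index \<open>N\<close> involve only nonconstant coefficients, so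
  the lower power sums of \<open>M\<close> and \<open>M'\<close> agree. The constant coefficient
  first enters the \<open>N\<close>-th identity, linearly and with factor \<open>N\<close>.\<close>

lemma power_sum_shift_const:
  fixes M M' :: "'b::field multiset"
  assumes eq: "lin_prod M' = lin_prod M + [:c:]" and N: "size M = N" "0 < N"
  shows "power_sum N M' = power_sum N M - of_nat N * c"
proof -
  have sz: "size M' = N"
  proof -
    have "degree (lin_prod M + [:c:]) = degree (lin_prod M)"
      using N by (intro degree_add_eq_left) auto
    thus ?thesis using N by (simp flip: eq)
  qed
  have co: "coeff (lin_prod M') i = coeff (lin_prod M) i" if "0 < i" for i
    using that by (cases i) (auto simp: eq)
  have rec: "power_sum k A = - of_nat k * coeff (lin_prod A) (N - k)
       - (\<Sum>i=1..<k. coeff (lin_prod A) (N - i) * power_sum (k - i) A)"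
    if "0 < k" "k \<le> N" "size A = N" for k and A :: "'b multiset"
  proof -
    have "coeff (lin_prod A) N = 1" using lead_coeff_lin_prod[of A] that by simp
    hence "(\<Sum>i<k. coeff (lin_prod A) (N - i) * power_sum (k - i) A) = power_sum k A +
        (\<Sum>i=1..<k. coeff (lin_prod A) (N - i) * power_sum (k - i) A)"
      using that(1) by (simp add: lessThan_atLeast0 sum.atLeast_Suc_lessThan)
    hence "of_nat k * coeff (lin_prod A) (N - k) = - (power_sum k A +
        (\<Sum>i=1..<k. coeff (lin_prod A) (N - i) * power_sum (k - i) A))"
      using newton_identity[of k A] that by simp
    thus ?thesis by simp
  qed
  have less: "power_sum k M' = power_sum k M" if "0 < k" "k < N" for k
    using that
  proof (induction k rule: less_induct)
    case (less k)
    thus ?case using rec[of k M] rec[of k M'] N sz by (simp add: co)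
  qed
  have "(\<Sum>i=1..<N. coeff (lin_prod M') (N - i) * power_sum (N - i) M') = (\<Sum>i=1..<N. coeff (lin_prod M) (N - i) * power_sum (N - i) M)"
    by (intro sum.cong refl arg_cong2[of _ _ _ _ "(*)"] less co) auto
  hence "power_sum N M' = - of_nat N * (coeff (lin_prod M) 0 + c)
      - (\<Sum>i=1..<N. coeff (lin_prod M) (N - i) * power_sum (N - i) M)"
    using rec[of N M'] N sz by (simp add: eq)
  moreover have "power_sum N M = - of_nat N * coeff (lin_prod M) 0
      - (\<Sum>i=1..<N. coeff (lin_prod M) (N - i) * power_sum (N - i) M)"
    using rec[of N M] N by simp
  ultimately show ?thesis by (simp only: distrib_left) simp
qed

section \<open>Monic polynomials over the finite field and their root multisets\<close>

context field_characters begin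

definition root_mset :: "'a poly \<Rightarrow> 'a alg_closure multiset" where "root_mset f = proots (map_poly to_ac f)"
definition monics :: "nat \<Rightarrow> 'a poly set" where "monics k = {f. degree f = k \<and> lead_coeff f = 1}"

lemma degree_map_to_ac [simp]: "degree (map_poly to_ac (f :: 'a poly)) = degree f"
  by (rule degree_map_poly) auto

lemma lin_prod_root_mset: "f \<in> monics k \<Longrightarrow> lin_prod (root_mset f) = map_poly to_ac f"
  unfolding root_mset_def monics_def by (intro lin_prod_proots) (auto simp: coeff_map_poly)

lemma size_root_mset: "f \<in> monics k \<Longrightarrow> size (root_mset f) = k"
  using degree_lin_prod[of "root_mset f"] by (simp add: lin_prod_root_mset del: degree_lin_prod) (simp add: monics_def)

lemma coeff_lin_prod_root_mset: "f \<in> monics k \<Longrightarrow> coeff (lin_prod (root_mset f)) i = to_ac (coeff f i)"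
  by (simp add: lin_prod_root_mset coeff_map_poly)

lemma map_poly_frob_lin_prod: "map_poly frob (lin_prod M) = lin_prod (image_mset frob M)"
  by (induction M)
     (auto simp: map_poly_mult_hom frob_add frob_mult map_poly_pCons frob_uminus simp del: mult_pCons_left)

lemma image_frob_root_mset: "f \<in> monics k \<Longrightarrow> image_mset frob (root_mset f) = root_mset f"
proof -
  assume f: "f \<in> monics k"
  have "lin_prod (image_mset frob (root_mset f)) = map_poly frob (map_poly to_ac f)"
    by (simp add: lin_prod_root_mset[OF f] flip: map_poly_frob_lin_prod)
  also have "\<dots> = map_poly to_ac f" by (rule poly_eqI) (simp add: coeff_map_poly)
  finally have "lin_prod (image_mset frob (root_mset f)) = lin_prod (root_mset f)" by (simp add: lin_prod_root_mset[OF f])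
  thus ?thesis by (metis proots_lin_prod)
qed

text \<open>Surjectivity is descent: applying Frobenius to the coefficients of
  \<open>lin_prod M\<close> permutes the roots, so for stable \<open>M\<close> the coefficients lie
  in the base field. A nonzero constant coefficient means that 0 is not a root.\<close>

lemma bij_betw_root_mset:
  "bij_betw root_mset {f\<in>monics k. coeff f 0 \<noteq> 0} {M. stable M \<and> size M = k}"
proof (rule bij_betwI')
  fix f g assume "f \<in> {f\<in>monics k. coeff f 0 \<noteq> 0}" "g \<in> {f\<in>monics k. coeff f 0 \<noteq> 0}"
  hence f: "f \<in> monics k" "g \<in> monics k" by auto
  show "root_mset f = root_mset g \<longleftrightarrow> f = g"
  proof
    assume "root_mset f = root_mset g"
    hence "map_poly to_ac f = map_poly to_ac g" using f by (metis lin_prod_root_mset)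
    hence "coeff (map_poly to_ac f) i = coeff (map_poly to_ac g) i" for i by simp
    thus "f = g" by (intro poly_eqI) (simp add: coeff_map_poly)
  qed simp
next
  fix f assume f: "f \<in> {f\<in>monics k. coeff f 0 \<noteq> 0}"
  have "map_poly to_ac f \<noteq> 0" using f by (metis (mono_tags, lifting) lin_prod_nz lin_prod_root_mset mem_Collect_eq)
  hence "0 \<notin># root_mset f" using f by (simp add: root_mset_def poly_0_coeff_0 coeff_map_poly)
  thus "root_mset f \<in> {M. stable M \<and> size M = k}"
    using f image_frob_root_mset size_root_mset by (auto simp: stable_mset_def)
next
  fix M assume "M \<in> {M. stable M \<and> size M = k}"
  hence M: "image_mset frob M = M" "0 \<notin># M" "size M = k" by (auto simp: stable_mset_def)
  have "frob (coeff (lin_prod M) i) = coeff (lin_prod M) i" for i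
    using map_poly_frob_lin_prod[of M] by (metis M(1) coeff_map_poly frob_0)
  hence co: "to_ac (of_ac (coeff (lin_prod M) i)) = coeff (lin_prod M) i" for i
    using frob_eq_self_iff to_ac_of_ac by blast
  define f where "f = map_poly of_ac (lin_prod M)"
  have f: "map_poly to_ac f = lin_prod M"
    by (rule poly_eqI) (simp add: f_def coeff_map_poly co)
  have "degree f = k" using arg_cong[OF f, of degree] M by simp
  moreover have "to_ac (lead_coeff f) = 1"
    using lead_coeff_lin_prod[of M] M calculation by (simp add: coeff_map_poly del: lead_coeff_lin_prod flip: f)
  moreover have "to_ac (coeff f 0) = coeff (lin_prod M) 0" by (simp add: coeff_map_poly flip: f)
  hence "coeff f 0 \<noteq> 0" using M(2) by (auto simp: coeff_0_lin_prod)
  moreover have "root_mset f = M" by (simp add: root_mset_def f)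
  ultimately show "\<exists>f\<in>{f\<in>monics k. coeff f 0 \<noteq> 0}. M = root_mset f"
    by (intro bexI[of _ f]) (auto simp: monics_def simp flip: to_ac_1)
qed

lemma L_coeffs_eq_sum_monics:
  assumes "frobenius_weight frob (- {0}) w"
  shows "L_coeffs w k = (\<Sum>f\<in>{f\<in>monics k. coeff f 0 \<noteq> 0}. w (root_mset f))"
  unfolding frobenius_weight.L_coeff_def[OF assms] frobenius_weight.stab_def[OF assms]
  by (rule sum.reindex_bij_betw[OF bij_betw_root_mset, symmetric])

lemma mset_norm_root_mset:
  assumes f: "f \<in> monics k"
  shows "mset_norm (root_mset f) = (-1) ^ k * coeff f 0"
proof -
  have "to_ac (coeff f 0) = (-1) ^ k * prod_mset (root_mset f)"
    using coeff_0_lin_prod[of "root_mset f"] f by (simp add: coeff_lin_prod_root_mset size_root_mset)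
  hence "to_ac (mset_norm (root_mset f)) = to_ac ((-1) ^ k * coeff f 0)"
    using to_ac_mset_norm[OF image_frob_root_mset[OF f]] by (simp flip: power_mult_distrib mult.assoc)
  thus ?thesis by (simp only: to_ac_eq_iff)
qed

lemma mset_trace_root_mset:
  assumes f: "f \<in> monics k" and k: "0 < k"
  shows "mset_trace (root_mset f) = - coeff f (k - 1)"
proof -
  have "to_ac (mset_trace (root_mset f)) = to_ac (- coeff f (k - 1))"
    using coeff_lin_prod_sum[of "root_mset f"] k to_ac_mset_trace[OF image_frob_root_mset[OF f]]
    by (simp add: coeff_lin_prod_root_mset[OF f] size_root_mset[OF f])
  thus ?thesis by (simp only: to_ac_eq_iff)
qed

text \<open>A monic linear polynomial with root \<open>x\<close> has norm and trace both equal to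
  \<open>x\<close>.\<close>

lemma L_coeffs_weight_1: "L_coeffs (weight m) 1 = gauss \<psi> \<omega> m"
proof -
  have mem: "[:x, 1:] \<in> monics (Suc 0)" for x by (simp add: monics_def)
  have lin: "f \<in> monics (Suc 0) \<Longrightarrow> [:coeff f 0, 1:] = f" for f
    by (intro poly_eqI) (auto simp: monics_def coeff_pCons coeff_eq_0 split: nat.splits)
  have "L_coeffs (weight m) 1 = (\<Sum>f\<in>{f\<in>monics 1. coeff f 0 \<noteq> 0}. \<omega> (- coeff f 0) powi m * \<psi> (- coeff f 0))"
    unfolding L_coeffs_eq_sum_monics[OF frobenius_weight_weight]
    by (intro sum.cong) (auto simp: weight_def mset_norm_root_mset mset_trace_root_mset)
  also have "\<dots> = (\<Sum>x\<in>UNIV - {0}. \<omega> x powi m * \<psi> x)"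
    by (rule sum.reindex_bij_witness[of _ "\<lambda>x. [:-x, 1:]" "\<lambda>f. - coeff f 0"])
       (auto simp: mem lin)
  finally show ?thesis by (simp add: gauss_def)
qed

lemma monics_add: "f \<in> monics k \<Longrightarrow> degree g < k \<Longrightarrow> f + g \<in> monics k"
  by (auto simp: monics_def degree_add_eq_left lead_coeff_add_le coeff_eq_0)

text \<open>Adding \<open>monom (-c) (k - 1)\<close> raises the trace by \<open>c\<close> and, since
  \<open>k - 1 > 0\<close>, leaves the constant coefficient alone. The sum thus equals
  \<open>\<psi> c\<close> times itself, with \<open>\<psi> c\<close> different from 1.\<close>

lemma L_coeffs_weight_ge_2:
  assumes "2 \<le> k"
  shows "L_coeffs (weight m) k = 0"
proof -
  obtain c where c: "\<psi> c \<noteq> 1" using psi by (auto simp: nontrivial_add_char_def)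
  let ?A = "{f\<in>monics k. coeff f 0 \<noteq> 0}"
  have mem: "f + monom a (k - 1) \<in> ?A" if "f \<in> ?A" for f a
    using that assms degree_monom_le[of a "k - 1"] by (auto intro!: monics_add)
  have "L_coeffs (weight m) k = (\<Sum>f\<in>?A. weight m (root_mset f))"
    by (rule L_coeffs_eq_sum_monics[OF frobenius_weight_weight])
  also have "\<dots> = (\<Sum>f\<in>?A. weight m (root_mset (f + monom (-c) (k - 1))))"
    by (rule sum.reindex_bij_witness[of _ "\<lambda>f. f + monom (-c) (k - 1)" "\<lambda>f. f + monom c (k - 1)"])
       (use mem in \<open>auto simp: add.assoc add_monom\<close>)
  also have "\<dots> = (\<Sum>f\<in>?A. \<psi> c * weight m (root_mset f))"
  proof (rule sum.cong[OF refl])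
    fix f assume f: "f \<in> ?A"
    let ?g = "f + monom (-c) (k - 1)"
    have fm: "f \<in> monics k" and gm: "?g \<in> monics k" using f mem[OF f, of "-c"] by auto
    have k: "0 < k" using assms by simp
    have "coeff ?g 0 = coeff f 0" "- coeff ?g (k - 1) = c + - coeff f (k - 1)" using assms by auto
    thus "weight m (root_mset ?g) = \<psi> c * weight m (root_mset f)"
      unfolding weight_def mset_norm_root_mset[OF fm] mset_norm_root_mset[OF gm] mset_trace_root_mset[OF fm k] mset_trace_root_mset[OF gm k]
      by (simp only: psi_add) (simp only: mult_ac)
  qed
  also have "\<dots> = \<psi> c * L_coeffs (weight m) k"
    by (simp add: sum_distrib_left L_coeffs_eq_sum_monics[OF frobenius_weight_weight])
  finally show ?thesis using c by auto
qed

lemma L_series_weight: "Abs_fps (L_coeffs (weight m)) = 1 + fps_const (gauss \<psi> \<omega> m) * fps_X"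
proof (rule fps_ext)
  fix k :: nat
  consider "k = 0" | "k = 1" | "2 \<le> k" by linarith
  thus "Abs_fps (L_coeffs (weight m)) $ k = (1 + fps_const (gauss \<psi> \<omega> m) * fps_X) $ k"
    by cases (auto simp: frobenius_weight.L_coeff_0[OF frobenius_weight_weight] L_coeffs_weight_1[simplified] L_coeffs_weight_ge_2)
qed

lemma mset_norm_image_power: "image_mset frob M = M \<Longrightarrow> mset_norm (image_mset (\<lambda>z. z ^ k) M) = mset_norm M ^ k"
proof -
  assume M: "image_mset frob M = M"
  have "prod_mset (image_mset (\<lambda>z. z ^ k) M) = prod_mset M ^ k"
    by (induction M) (auto simp: power_mult_distrib)
  thus ?thesis unfolding mset_norm_def by (intro of_ac_eqI) (simp add: to_ac_mset_norm[OF M, unfolded mset_norm_def])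
qed

text \<open>By Newton's identities the \<open>N\<close>-th power sum of the roots of a monic polynomial of degree \<open>N\<close>
  is affine in the constant coefficient; this is what makes the top coefficient of the
  \<open>L\<close>-series factor into a Gauss sum and a constant independent of \<open>m\<close>.\<close>
lemma mset_trace_power_shift:
  assumes b: "b \<in> monics N" and N: "0 < N"
  shows "mset_trace (image_mset (\<lambda>z. z ^ N) (root_mset (b + [:c:]))) = mset_trace (image_mset (\<lambda>z. z ^ N) (root_mset b)) - of_nat N * c"
proof -
  have bc: "b + [:c:] \<in> monics N" using b N by (intro monics_add) auto
  have fr: "image_mset frob (image_mset (\<lambda>z. z ^ N) (root_mset f)) = image_mset (\<lambda>z. z ^ N) (root_mset f)"
    if f: "f \<in> monics N" for f
  proof -
    have "image_mset frob (image_mset (\<lambda>z. z ^ N) (root_mset f)) = image_mset (\<lambda>z. z ^ N) (image_mset frob (root_mset f))"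
      by (simp add: image_mset.compositionality comp_def frob_power)
    thus ?thesis by (simp add: image_frob_root_mset[OF f])
  qed
  have "lin_prod (root_mset (b + [:c:])) = lin_prod (root_mset b) + [:to_ac c:]"
    by (rule poly_eqI) (auto simp: coeff_lin_prod_root_mset[OF b] coeff_lin_prod_root_mset[OF bc] coeff_pCons split: nat.splits)
  from power_sum_shift_const[OF this size_root_mset[OF b] N]
  have "to_ac (mset_trace (image_mset (\<lambda>z. z ^ N) (root_mset (b + [:c:])))) = to_ac (mset_trace (image_mset (\<lambda>z. z ^ N) (root_mset b)) - of_nat N * c)"
    using to_ac_mset_trace[OF fr[OF b]] to_ac_mset_trace[OF fr[OF bc]] by (simp add: power_sum_def)
  thus ?thesis by (simp only: to_ac_eq_iff)
qed

text \<open>Each \<open>f\<close> is split as \<open>b + [:c:]\<close> with \<open>b\<close>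
  vanishing at 0. The norm depends on \<open>c\<close> alone and the trace is a function of
  \<open>b\<close> minus \<open>N * c\<close>, so the sum over \<open>b\<close> factors out as the
  constant \<open>C\<close>.\<close>

lemma L_coeffs_weight_pow_top:
  assumes "N dvd n"
  shows "\<exists>C. \<forall>m. L_coeffs (weight_pow N m) N = C * (\<omega> (of_nat N) powi (- int N * m) * gauss \<psi> \<omega> (int N * m))"
proof (intro exI allI)
  fix m
  have N: "N > 0" using assms n_pos by (auto intro: Nat.gr0I)
  have N0: "of_nat N \<noteq> (0::'a)" by (rule of_nat_dvd_n_nz[OF assms])
  let ?B = "{b\<in>monics N. coeff b 0 = 0}"
  let ?p = "\<lambda>f. mset_trace (image_mset (\<lambda>z. z ^ N) (root_mset f))"
  have "L_coeffs (weight_pow N m) N = (\<Sum>f\<in>{f\<in>monics N. coeff f 0 \<noteq> 0}. \<omega> (((-1) ^ N * coeff f 0) ^ N) powi m * \<psi> (?p f))"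
    unfolding L_coeffs_eq_sum_monics[OF frobenius_weight_weight_pow]
    by (intro sum.cong refl) (auto simp: weight_pow_def weight_def mset_norm_image_power image_frob_root_mset mset_norm_root_mset)
  also have "\<dots> = (\<Sum>(b,c)\<in>?B \<times> (UNIV - {0}). \<omega> (((-1) ^ N * c) ^ N) powi m * \<psi> (?p (b + [:c:])))"
  proof (rule sum.reindex_bij_witness[of _ "\<lambda>(b,c). b + [:c:]" "\<lambda>f. (f + [:- coeff f 0:], coeff f 0)"], goal_cases)
    case (2 f) thus ?case using N by (auto intro!: monics_add)
  next
    case (4 f) thus ?case using N by (auto intro!: monics_add)
  next
    case (5 f)
    have "f + [:- coeff f 0:] + [:coeff f 0:] = f" by (simp add: add.assoc)
    thus ?case by (simp only: prod.case)
  qed auto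
  also have "\<dots> = (\<Sum>b\<in>?B. \<Sum>c\<in>UNIV - {0}. \<omega> (((-1) ^ N * c) ^ N) powi m * \<psi> (?p (b + [:c:])))"
    by (rule sum.cartesian_product[symmetric])
  also have "\<dots> = (\<Sum>b\<in>?B. \<psi> (?p b) * (\<Sum>c\<in>UNIV - {0}. \<omega> (((-1) ^ N * c) ^ N) powi m * \<psi> (- of_nat N * c)))"
    unfolding sum_distrib_left
    by (intro sum.cong refl) (auto simp: mset_trace_power_shift[OF _ N] psi_add[of _ "- (_ * _)", simplified])
  also have "(\<Sum>c\<in>UNIV - {0}. \<omega> (((-1) ^ N * c) ^ N) powi m * \<psi> (- of_nat N * c)) =
     (\<Sum>x\<in>UNIV - {0}. \<omega> (of_nat N) powi (- int N * m) * (\<omega> x powi (int N * m) * \<psi> x))"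
  \<comment> \<open>Substitution \<open>x = - N * c\<close>, invertible because \<open>N\<close> is
    nonzero in the field; it makes the argument of \<open>\<psi>\<close> equal to
    \<open>x\<close>.\<close>
  proof (rule sum.reindex_bij_witness[of _ "\<lambda>x. - x / of_nat N" "\<lambda>c. - c * of_nat N"], goal_cases)
    case (5 c)
    \<comment> \<open>\<open>N * N\<close> and \<open>N\<close> have the same parity.\<close>
    have "((-1) ^ N * c) ^ N = (- c) ^ N"
      by (cases "even N") (auto simp: power_mult_distrib)
    also have "\<omega> ((- c) ^ N) powi m = \<omega> (- c) powi (int N * m)"
      using 5 by (simp add: omega_power power_int_mult)
    also have "- c = (- c * of_nat N) * inverse (of_nat N)" using N0 by simp
    also have "\<omega> \<dots> powi (int N * m) = \<omega> (- c * of_nat N) powi (int N * m) * \<omega> (of_nat N) powi (- int N * m)"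
      using 5 N0 by (subst omega_powi_mult) (auto simp: omega_inverse power_int_minus power_int_inverse)
    finally show ?case by (simp add: mult_ac)
  qed (use N0 in auto)
  also have "\<dots> = \<omega> (of_nat N) powi (- int N * m) * gauss \<psi> \<omega> (int N * m)"
    by (simp add: gauss_def sum_distrib_left)
  finally show "L_coeffs (weight_pow N m) N = (\<Sum>b\<in>?B. \<psi> (?p b)) * (\<omega> (of_nat N) powi (- int N * m) * gauss \<psi> \<omega> (int N * m))"
    by (simp add: sum_distrib_right)
qed

theorem hasse_davenport_product:
  assumes N: "N * N' = n"
  shows "(\<Prod>j<N. gauss \<psi> \<omega> (m + int j * int N')) =
    - (\<Prod>j<N. gauss \<psi> \<omega> (int j * int N')) * \<omega> (of_nat N) powi (- int N * m) * gauss \<psi> \<omega> (int N * m)"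
proof -
  have "N dvd n" using N by (metis dvd_triv_left)
  from L_coeffs_weight_pow_top[OF this] obtain C where
    C: "\<And>m. L_coeffs (weight_pow N m) N = C * (\<omega> (of_nat N) powi (- int N * m) * gauss \<psi> \<omega> (int N * m))"
    by blast
  have top: "L_coeffs (weight_pow N m) N = (\<Prod>j<N. gauss \<psi> \<omega> (m + int j * int N'))" for m
  proof -
    have "L_coeffs (weight_pow N m) N = Abs_fps (L_coeffs (weight_pow N m)) $ N" by simp
    also have "\<dots> = (\<Prod>j<N. gauss \<psi> \<omega> (m + int j * int N'))"
      unfolding L_series_weight_pow[OF N] L_series_weight by (rule fps_prod_linear_top_coeff)
    finally show ?thesis .
  qed
  \<comment> \<open>At \<open>m = 0\<close> the remaining Gauss sum is \<open>-1\<close>, which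
    identifies \<open>C\<close>.\<close>
  have "(\<Prod>j<N. gauss \<psi> \<omega> (int j * int N')) = - C"
    using top[of 0] C[of 0] by (simp add: gauss_0)
  thus ?thesis using top[of m] C[of m] by (simp add: mult.assoc)
qed

end

section \<open>Multiplicities of roots of unity\<close>

lemma order_gcd_poly:
  fixes p q :: "complex poly"
  assumes "p \<noteq> 0" "q \<noteq> 0"
  shows "order a (gcd p q) = min (order a p) (order a q)"
proof -
  have "k \<le> order a (gcd p q) \<longleftrightarrow> k \<le> min (order a p) (order a q)" for k
  proof -
    have "k \<le> order a (gcd p q) \<longleftrightarrow> [:-a, 1:] ^ k dvd gcd p q"
      using assms by (subst order_divides) auto
    also have "\<dots> \<longleftrightarrow> [:-a, 1:] ^ k dvd p \<and> [:-a, 1:] ^ k dvd q" by (rule gcd_greatest_iff)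
    finally show ?thesis using assms by (simp add: order_divides)
  qed
  thus ?thesis by (meson antisym order.refl)
qed

lemma order_prod_list_map:
  fixes f :: "'i \<Rightarrow> 'b::idom poly"
  assumes "\<And>x. x \<in> set xs \<Longrightarrow> f x \<noteq> 0"
  shows "order a (\<Prod>x\<leftarrow>xs. f x) = (\<Sum>x\<leftarrow>xs. order a (f x))"
  using assms
proof (induction xs)
  case (Cons x xs)
  have "(\<Prod>x\<leftarrow>xs. f x) \<noteq> 0" using Cons.prems by (auto simp: prod_list_zero_iff)
  thus ?case using Cons by (simp add: order_mult)
qed simp

lemma prod_power_sum_list:
  "(\<Prod>x\<leftarrow>xs. \<Prod>c\<in>I. G c ^ o' c x) = (\<Prod>c\<in>I. G c ^ (\<Sum>x\<leftarrow>xs. o' c x) :: 'b::comm_monoid_mult)"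
  by (induction xs) (auto simp: power_add prod.distrib)

lemma xpm1_nz: "0 < p \<Longrightarrow> xpm1 p \<noteq> 0"
proof
  assume p: "0 < p" "xpm1 p = 0"
  hence "coeff (xpm1 p) p = 0" by simp
  thus False using p(1) by (simp add: xpm1_def)
qed

text \<open>All zeros are simple, since the derivative of \<open>X ^ p - 1\<close> does not vanish
  at a nonzero point.\<close>

lemma order_xpm1:
  assumes "0 < p"
  shows "order z (xpm1 p) = (if z ^ p = 1 then 1 else 0)"
proof (cases "z ^ p = 1")
  case True
  have z: "z \<noteq> 0" using True assms by (auto simp: power_0_left)
  have pd: "poly (pderiv (xpm1 p)) z \<noteq> 0"
    using assms z by (simp add: xpm1_def pderiv_diff pderiv_monom poly_monom)
  have "order z (xpm1 p) = Suc (order z (pderiv (xpm1 p)))"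
    by (rule order_pderiv[OF xpm1_nz[OF assms]]) (use True in \<open>simp add: xpm1_def poly_monom\<close>)
  thus ?thesis using True pd by (simp add: order_0I)
next
  case False
  thus ?thesis by (simp add: order_0I xpm1_def poly_monom)
qed

lemma order_linear_factor: "order a [:- b, 1 :: 'b::field:] = (if a = b then 1 else 0)"
proof -
  have "count (proots [:-b, 1:]) a = (if a = b then 1 else 0)" by (simp del: count_proots)
  thus ?thesis by (subst (asm) count_proots) auto
qed

section \<open>Roots of unity indexed by residues modulo \<open>n\<close>\<close>

context field_characters begin

text \<open>With this indexing the zero \<open>unit_root c\<close> of a polynomial corresponds to
  the shift \<open>c\<close> in the argument of a Gauss sum.\<close>

definition unit_root :: "int \<Rightarrow> complex" where "unit_root c = cis (2 * pi * of_int c / of_nat n)"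

lemma unit_root_add: "unit_root (c + d) = unit_root c * unit_root d"
  by (simp add: unit_root_def cis_mult add_divide_distrib distrib_left)

lemma unit_root_power: "unit_root c ^ k = unit_root (int k * c)"
  by (simp add: unit_root_def DeMoivre mult_ac)

lemma unit_root_eq_1_iff: "unit_root c = 1 \<longleftrightarrow> int n dvd c"
proof -
  have per: "unit_root (int n * k) = 1" for k
  proof -
    have "2 * pi * of_int (int n * k) / of_nat n = 2 * pi * of_int k" using n_pos by simp
    thus ?thesis unfolding unit_root_def by (simp only: cis_multiple_2pi Ints_of_int)
  qed
  show ?thesis
  proof
    assume "unit_root c = 1"
    have "unit_root c = unit_root (int n * (c div int n)) * unit_root (c mod int n)" by (simp flip: unit_root_add)
    hence 1: "unit_root (c mod int n) = 1" using \<open>unit_root c = 1\<close> per by simp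
    define k where "k = nat (c mod int n)"
    have k: "int k = c mod int n" using n_pos by (simp add: k_def)
    have "int k < int n" unfolding k using n_pos by (intro pos_mod_bound) auto
    hence "k < n" by simp
    have "inj_on (\<lambda>k. cis (2 * pi * real k / real n)) {..<n}"
      using bij_betw_roots_unity[OF n_pos] by (rule bij_betw_imp_inj_on)
    hence "k = 0"
      by (rule inj_onD) (use 1 \<open>k < n\<close> n_pos in \<open>auto simp: unit_root_def simp flip: k\<close>)
    thus "int n dvd c" using k by (simp add: dvd_eq_mod_eq_0)
  next
    assume "int n dvd c"
    thus "unit_root c = 1" using per by (auto elim!: dvdE)
  qed
qed

lemma unit_root_eq_iff: "unit_root c = unit_root d \<longleftrightarrow> c mod int n = d mod int n"
proof -
  have nz: "unit_root d \<noteq> 0" by (simp add: unit_root_def)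
  have "unit_root c = unit_root (c - d) * unit_root d" by (simp flip: unit_root_add)
  hence "unit_root c = unit_root d \<longleftrightarrow> unit_root (c - d) = 1" using nz by auto
  thus ?thesis by (simp add: unit_root_eq_1_iff mod_eq_dvd_iff)
qed

lemma expi_eq_unit_root:
  assumes "a * of_nat n \<in> \<int>"
  shows "expi a = unit_root \<lfloor>a * of_nat n\<rfloor>"
proof -
  have "of_int \<lfloor>a * of_nat n\<rfloor> = a * of_nat n" using assms by (simp add: of_int_floor)
  hence "(of_rat (of_int \<lfloor>a * of_nat n\<rfloor>) :: real) = of_rat (a * of_nat n)" by (simp only:)
  hence eq: "of_int \<lfloor>a * of_nat n\<rfloor> / of_nat n = (of_rat a :: real)"
    using n_pos by (simp add: of_rat_mult)
  have unit_root: "unit_root \<lfloor>a * of_nat n\<rfloor> = cis (2 * pi * of_rat a)" unfolding unit_root_def by (simp flip: eq)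
  have "of_real (of_rat a) = (of_rat a :: complex)" by (cases a) (simp add: of_rat_rat)
  hence "cis (2 * pi * of_rat a) = expi a"
    unfolding expi_def cis_conv_exp by (simp add: mult_ac)
  with unit_root show ?thesis by simp
qed

lemma exp_eq_unit_root: "exp (2 * of_real pi * \<i> * of_nat k / of_nat n) = unit_root (int k)"
  unfolding unit_root_def cis_conv_exp by (rule arg_cong[of _ _ exp]) (simp add: mult_ac)

definition residues :: "int set" where "residues = {0..<int n}"

lemma mod_in_residues: "c mod int n \<in> residues"
  using n_pos by (simp add: residues_def)

lemma finite_residues [simp]: "finite residues" by (simp add: residues_def)

lemma residues_mod: "c \<in> residues \<Longrightarrow> c mod int n = c"
  by (simp add: residues_def)

text \<open>A product over a list of shifts becomes a product over residues with zero multiplicities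
  as exponents, so that relations between polynomials turn into relations between products of Gauss
  sums.\<close>

lemma prod_list_eq_prod_order:
  fixes G :: "int \<Rightarrow> complex"
  assumes "\<And>c. G (c mod int n) = G c"
  shows "(\<Prod>c\<leftarrow>cs. G c) = (\<Prod>c\<in>residues. G c ^ order (unit_root c) (\<Prod>c\<leftarrow>cs. [:- unit_root c, 1:]))"
proof -
  have *: "G d = (\<Prod>c\<in>residues. G c ^ order (unit_root c) [:- unit_root d, 1:])" for d
  proof -
    have "(\<Prod>c\<in>residues. G c ^ order (unit_root c) [:- unit_root d, 1:]) = (\<Prod>c\<in>residues. if c = d mod int n then G c else 1)"
      by (rule prod.cong) (auto simp: order_linear_factor unit_root_eq_iff residues_mod)
    also have "\<dots> = G (d mod int n)" by (simp add: prod.delta mod_in_residues)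
    finally show ?thesis by (simp add: assms)
  qed
  have "(\<Prod>c\<leftarrow>cs. G c) = (\<Prod>d\<leftarrow>cs. \<Prod>c\<in>residues. G c ^ order (unit_root c) [:- unit_root d, 1:])"
    by (intro arg_cong[of _ _ prod_list] map_cong refl *)
  thus ?thesis by (simp add: prod_power_sum_list order_prod_list_map)
qed

text \<open>The zeros of \<open>X ^ N - 1\<close> are simple and are the \<open>unit_root c\<close>
  with \<open>N'\<close> dividing \<open>c\<close>.\<close>

lemma prod_multiples_eq_prod_order:
  fixes G :: "int \<Rightarrow> complex"
  assumes N: "N * N' = n"
  shows "(\<Prod>j<N. G (int j * int N')) = (\<Prod>c\<in>residues. G c ^ order (unit_root c) (xpm1 N))"
proof -
  have pos: "0 < N" "0 < N'" using N n_pos by (auto intro: Nat.gr0I)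
  have iff: "unit_root c ^ N = 1 \<longleftrightarrow> int N' dvd c" for c
    using pos by (simp add: unit_root_power unit_root_eq_1_iff flip: N)
  have "(\<Prod>c\<in>residues. G c ^ order (unit_root c) (xpm1 N)) = (\<Prod>c\<in>residues. if int N' dvd c then G c else 1)"
    by (rule prod.cong) (auto simp: order_xpm1 pos iff)
  also have "\<dots> = (\<Prod>c\<in>{c\<in>residues. int N' dvd c}. G c)" by (simp add: prod.inter_filter)
  also have "\<dots> = (\<Prod>j<N. G (int j * int N'))"
  proof (rule prod.reindex_bij_witness[of _ "\<lambda>j. int j * int N'" "\<lambda>c. nat (c div int N')"], goal_cases)
    case (1 c) thus ?case by (auto elim!: dvdE simp: residues_def zero_le_mult_iff pos)
  next
    case (2 c)
    then obtain k where k: "c = int N' * k" "0 \<le> c" "c < int N * int N'" by (auto elim!: dvdE simp: residues_def N simp flip: of_nat_mult)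
    have "0 \<le> k" using k pos by (simp add: zero_le_mult_iff)
    moreover have "k < int N" using k pos by (simp add: mult.commute)
    ultimately show ?case using k pos by auto
  next
    case (3 j) thus ?case using pos by simp
  next
    case (4 j) thus ?case using pos by (auto simp: residues_def simp flip: N)
  next
    case (5 c) thus ?case using pos by (auto elim!: dvdE simp: residues_def zero_le_mult_iff)
  qed
  finally show ?thesis ..
qed

lemma prod_list_xpm1_eq_prod_order:
  fixes G :: "int \<Rightarrow> complex"
  assumes "\<And>p. p \<in> set ps \<Longrightarrow> p dvd n"
  shows "(\<Prod>p\<leftarrow>ps. \<Prod>j<p. G (int j * int (n div p))) = (\<Prod>c\<in>residues. G c ^ order (unit_root c) (\<Prod>p\<leftarrow>ps. xpm1 p))"
proof -
  have pos: "0 < p" if "p \<in> set ps" for p using assms[OF that] n_pos by (auto intro: Nat.gr0I)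
  have "(\<Prod>p\<leftarrow>ps. \<Prod>j<p. G (int j * int (n div p))) = (\<Prod>p\<leftarrow>ps. \<Prod>c\<in>residues. G c ^ order (unit_root c) (xpm1 p))"
    using assms by (intro arg_cong[of _ _ prod_list] map_cong refl prod_multiples_eq_prod_order) simp
  thus ?thesis using pos by (simp add: prod_power_sum_list order_prod_list_map xpm1_nz)
qed

section \<open>Product and reflection formulas as quotients\<close>

lemma hasse_davenport_quotient:
  assumes "N dvd n"
  shows "(\<Prod>j<N. gauss \<psi> \<omega> (m + int j * int (n div N)) / gauss \<psi> \<omega> (int j * int (n div N)))
    = - (\<omega> (of_nat N) powi (- int N * m) * gauss \<psi> \<omega> (int N * m))"
proof -
  have "N * (n div N) = n" using assms by simp
  from hasse_davenport_product[OF this, of m] show ?thesis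
    by (simp add: prod_dividef gauss_nz field_simps)
qed

lemma prod_multiples_reflect:
  fixes G :: "int \<Rightarrow> complex"
  assumes N: "N * N' = n" and G: "\<And>c. G (c mod int n) = G c"
  shows "(\<Prod>j<N. G (- (int j * int N'))) = (\<Prod>j<N. G (int j * int N'))"
\<comment> \<open>Modulo \<open>n\<close>, negation sends the multiple with index \<open>j\<close>
  to that with index \<open>N - j\<close>; the outer \<open>mod N\<close> keeps \<open>j = 0\<close>
  fixed.\<close>
proof (rule prod.reindex_bij_witness[of _ "\<lambda>j. (N - j) mod N" "\<lambda>j. (N - j) mod N"], goal_cases)
  case (5 j)
  show ?case
  proof (cases "j = 0")
    case False
    hence "int ((N - j) mod N) = int N - int j" using 5 by auto
    hence "int ((N - j) mod N) * int N' = int n + (- (int j * int N'))"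
      by (simp only: left_diff_distrib) (simp flip: N)
    hence "(int ((N - j) mod N) * int N') mod int n = (- (int j * int N')) mod int n" by simp
    thus ?thesis using G by metis
  qed simp
next
  case (1 j) thus ?case by (cases "j = 0") auto
next
  case (3 j) thus ?case by (cases "j = 0") auto
qed auto

lemma hasse_davenport_quotient_neg:
  assumes "N dvd n"
  shows "(\<Prod>j<N. gauss \<psi> \<omega> (- m - int j * int (n div N)) / gauss \<psi> \<omega> (- (int j * int (n div N))))
    = - (\<omega> (of_nat N) powi (int N * m) * gauss \<psi> \<omega> (- (int N * m)))"
proof -
  define G where "G = (\<lambda>c. gauss \<psi> \<omega> (- m + c) / gauss \<psi> \<omega> c)"
  have N: "N * (n div N) = n" using assms by simp
  have G: "G (c mod int n) = G c" for c
    unfolding G_def by (intro arg_cong2[of _ _ _ _ "(/)"] gauss_mod) (auto simp: mod_simps)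
  have "(\<Prod>j<N. G (- (int j * int (n div N)))) = (\<Prod>j<N. G (int j * int (n div N)))"
    by (rule prod_multiples_reflect[where G = G, OF N G])
  also have "\<dots> = - (\<omega> (of_nat N) powi (- int N * - m) * gauss \<psi> \<omega> (int N * - m))"
    unfolding G_def by (rule hasse_davenport_quotient[OF assms])
  finally show ?thesis unfolding G_def diff_conv_add_uminus by simp
qed

text \<open>For the trivial character both Gauss sums are \<open>-1\<close>, so the factor
  \<open>q\<close> is replaced by 1. This exception is the source of the powers of \<open>q\<close>
  in the final formula.\<close>

lemma gauss_reflect:
  "gauss \<psi> \<omega> c * gauss \<psi> \<omega> (- c) = \<omega> (-1) powi c * (if int n dvd c then 1 else of_nat q)"
proof (cases "int n dvd c")
  case True
  have "gauss \<psi> \<omega> c = gauss \<psi> \<omega> 0" "gauss \<psi> \<omega> (- c) = gauss \<psi> \<omega> 0"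
    using True by (intro gauss_mod; simp)+
  moreover have "\<omega> (-1) powi c = \<omega> (-1) powi 0" using True by (intro omega_powi_mod) auto
  ultimately show ?thesis using True by (simp add: gauss_0)
qed (simp add: gauss_mult_gauss_uminus)

text \<open>After the signs cancel, each base is \<open>h (m + c) / h c\<close> with
  \<open>h\<close> equal to 1 at multiples of \<open>n\<close> and to \<open>q\<close> elsewhere.
  The numerators lack a factor \<open>q\<close> only at \<open>c\<close> congruent to
  \<open>-m\<close>, the denominators only at \<open>c = 0\<close>.\<close>

lemma prod_reflect_powers:
  fixes D :: "int \<Rightarrow> nat"
  shows "(\<Prod>c\<in>residues. (gauss \<psi> \<omega> (m + c) / gauss \<psi> \<omega> c *
      (\<omega> (-1) powi m * gauss \<psi> \<omega> (- m - c) / gauss \<psi> \<omega> (- c))) ^ D c)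
    = of_nat q powi (int (D 0) - int (D ((- m) mod int n)))"
proof -
  define h where "h = (\<lambda>c. if int n dvd c then 1 else of_nat q :: complex)"
  have w0: "\<omega> (-1) \<noteq> 0" by (simp add: omega_nz)
  have ww: "\<omega> (-1) * \<omega> (-1) = 1" using omega_mult[of "-1" "-1"] by simp
  have wwm: "\<omega> (-1) powi m * \<omega> (-1) powi m = 1" by (simp add: ww flip: power_int_mult_distrib)
  have q0: "(of_nat q :: complex) \<noteq> 0" using q_eq by (simp del: of_nat_Suc)
  have one: "gauss \<psi> \<omega> (m + c) / gauss \<psi> \<omega> c * (\<omega> (-1) powi m * gauss \<psi> \<omega> (- m - c) / gauss \<psi> \<omega> (- c))
    = h (m + c) / h c" for c
  proof -
    have 1: "gauss \<psi> \<omega> (m + c) * gauss \<psi> \<omega> (- m - c) = \<omega> (-1) powi m * \<omega> (-1) powi c * h (m + c)"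
      using gauss_reflect[of "m + c"] w0 by (simp add: h_def power_int_add)
    have 2: "gauss \<psi> \<omega> c * gauss \<psi> \<omega> (- c) = \<omega> (-1) powi c * h c"
      using gauss_reflect[of c] by (simp add: h_def)
    have "gauss \<psi> \<omega> (m + c) / gauss \<psi> \<omega> c * (\<omega> (-1) powi m * gauss \<psi> \<omega> (- m - c) / gauss \<psi> \<omega> (- c))
      = \<omega> (-1) powi m * (gauss \<psi> \<omega> (m + c) * gauss \<psi> \<omega> (- m - c)) / (gauss \<psi> \<omega> c * gauss \<psi> \<omega> (- c))"
      by simp
    also have "\<dots> = (\<omega> (-1) powi m * \<omega> (-1) powi m) * (\<omega> (-1) powi c * h (m + c)) / (\<omega> (-1) powi c * h c)"
      unfolding 1 2 by (simp add: mult_ac)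
    also have "\<dots> = h (m + c) / h c" using w0 by (simp add: wwm)
    finally show ?thesis .
  qed
  have prodh: "(\<Prod>c\<in>residues. h (k + c) ^ D c) * of_nat q ^ D ((- k) mod int n) = of_nat q ^ (\<Sum>c\<in>residues. D c)" for k
  proof -
    let ?d = "(- k) mod int n"
    have iff: "int n dvd k + c \<longleftrightarrow> c = ?d" if "c \<in> residues" for c
    proof -
      have "int n dvd k + c \<longleftrightarrow> c mod int n = (- k) mod int n"
        by (simp add: mod_eq_dvd_iff add.commute)
      thus ?thesis by (simp add: residues_mod[OF that])
    qed
    have "(\<Prod>c\<in>residues. h (k + c) ^ D c) = (\<Prod>c\<in>residues - {?d}. h (k + c) ^ D c)"
      using prod.remove[of residues ?d "\<lambda>c. h (k + c) ^ D c"] mod_in_residues[of "-k"] iff by (simp add: h_def)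
    also have "\<dots> = (\<Prod>c\<in>residues - {?d}. of_nat q ^ D c)"
      by (rule prod.cong) (auto simp: h_def iff)
    finally show ?thesis
      using prod.remove[of residues ?d "\<lambda>c. (of_nat q :: complex) ^ D c"] mod_in_residues[of "-k"]
      by (simp add: power_sum mult.commute)
  qed
  have h0: "h c \<noteq> 0" for c using q0 by (simp add: h_def)
  have "(\<Prod>c\<in>residues. h (m + c) ^ D c) * of_nat q ^ D ((- m) mod int n) = (\<Prod>c\<in>residues. h c ^ D c) * of_nat q ^ D 0"
    using prodh[of m] prodh[of 0] by simp
  hence "(\<Prod>c\<in>residues. h (m + c) ^ D c) / (\<Prod>c\<in>residues. h c ^ D c) = of_nat q ^ D 0 / of_nat q ^ D ((- m) mod int n)"
    using h0 q0 by (simp add: field_simps)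
  thus ?thesis unfolding one power_divide prod_dividef using q0 by (simp add: power_int_diff)
qed

section \<open>Finite hypergeometric sums\<close>

text \<open>Roots of \<open>X ^ p - 1\<close> are closed under inversion; this later replaces the
  multiplicity at \<open>-m\<close> by the one at \<open>m\<close>.\<close>

lemma order_prod_xpm1_uminus:
  assumes "\<And>p. p \<in> set ps \<Longrightarrow> 0 < p"
  shows "order (unit_root (- c)) (\<Prod>p\<leftarrow>ps. xpm1 p) = order (unit_root c) (\<Prod>p\<leftarrow>ps. xpm1 p)"
proof -
  have "order (unit_root (- c)) (xpm1 p) = order (unit_root c) (xpm1 p)" if "p \<in> set ps" for p
    using assms[OF that] by (simp add: order_xpm1 unit_root_power unit_root_eq_1_iff)
  thus ?thesis using assms
    by (simp add: order_prod_list_map xpm1_nz cong: map_cong)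
qed

text \<open>Taking multiplicities in \<open>ratfun\<close> gives one linear relation, and
  non-congruence makes the multiplicity in the \<open>as\<close> product or in the \<open>bs\<close>
  product vanish at each \<open>z\<close>. The minimum of the other two multiplicities is then
  exactly the part that cancels.\<close>

lemma order_hypergeometric_data:
  fixes as bs :: "rat list" and ps qs :: "nat list"
  defines "D \<equiv> gcd (\<Prod>p\<leftarrow>ps. xpm1 p) (\<Prod>q\<leftarrow>qs. xpm1 q)"
  assumes noncong: "\<forall>a\<in>set as. \<forall>b\<in>set bs. a - b \<notin> \<int>"
    and ratfun: "(\<Prod>a\<leftarrow>as. [:- expi a, 1:]) * (\<Prod>q\<leftarrow>qs. xpm1 q)
               = (\<Prod>b\<leftarrow>bs. [:- expi b, 1:]) * (\<Prod>p\<leftarrow>ps. xpm1 p)"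
    and aint: "\<forall>a\<in>set as. a * of_nat n \<in> \<int>" and bint: "\<forall>b\<in>set bs. b * of_nat n \<in> \<int>"
    and pos: "\<forall>p\<in>set ps \<union> set qs. 0 < p"
  shows "order z (\<Prod>p\<leftarrow>ps. xpm1 p) = order z (\<Prod>a\<leftarrow>as. [:- expi a, 1:]) + order z D"
    and "order z (\<Prod>q\<leftarrow>qs. xpm1 q) = order z (\<Prod>b\<leftarrow>bs. [:- expi b, 1:]) + order z D"
proof -
  let ?A = "\<Prod>a\<leftarrow>as. [:- expi a, 1:]" and ?B = "\<Prod>b\<leftarrow>bs. [:- expi b, 1:]"
  let ?P = "\<Prod>p\<leftarrow>ps. xpm1 p" and ?Q = "\<Prod>q\<leftarrow>qs. xpm1 q"
  have nz: "?A \<noteq> 0" "?B \<noteq> 0" "?P \<noteq> 0" "?Q \<noteq> 0"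
    using pos by (auto simp: prod_list_zero_iff xpm1_nz)
  have sum: "order z ?A + order z ?Q = order z ?B + order z ?P"
    using arg_cong[OF ratfun, of "order z"] nz by (simp add: order_mult)
  \<comment> \<open>A common zero would give \<open>expi a = expi b\<close>. By integrality of
    \<open>a * n\<close> and \<open>b * n\<close> the floors are exact, so this forces
    \<open>a - b\<close> to be an integer.\<close>
  have disj: "order z ?A = 0 \<or> order z ?B = 0"
  proof (rule ccontr)
    assume "\<not> ?thesis"
    hence "poly ?A z = 0" "poly ?B z = 0" using nz by (auto simp: order_root)
    moreover have "poly (\<Prod>x\<leftarrow>xs. [:- expi x, 1:]) z = 0 \<longleftrightarrow> z \<in> expi ` set xs" for xs
      by (induction xs) auto
    ultimately obtain a b where ab: "a \<in> set as" "b \<in> set bs" "z = expi a" "z = expi b" by auto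
    have an: "a * of_nat n \<in> \<int>" and bn: "b * of_nat n \<in> \<int>" using ab aint bint by auto
    have "unit_root \<lfloor>a * of_nat n\<rfloor> = unit_root \<lfloor>b * of_nat n\<rfloor>" using ab an bn by (simp flip: expi_eq_unit_root)
    then obtain k where k: "\<lfloor>a * of_nat n\<rfloor> = \<lfloor>b * of_nat n\<rfloor> + int n * k"
      by (metis unit_root_eq_iff mod_eqE)
    have "(of_int \<lfloor>a * of_nat n\<rfloor> :: rat) = of_int \<lfloor>b * of_nat n\<rfloor> + of_nat n * of_int k"
      unfolding k by simp
    hence "a * of_nat n = b * of_nat n + of_nat n * of_int k"
      using an bn by (simp only: of_int_floor)
    hence "(a - b) * of_nat n = of_int k * of_nat n" by (simp add: algebra_simps)
    hence "a - b = of_int k" using n_pos by simp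
    thus False using noncong ab by (metis Ints_of_int)
  qed
  have D: "order z D = min (order z ?P) (order z ?Q)"
    unfolding D_def by (rule order_gcd_poly) (use nz in auto)
  show "order z ?P = order z ?A + order z D" "order z ?Q = order z ?B + order z D"
    using sum disj unfolding D by auto
qed

lemma of_nat_prod_list_powers_nz:
  assumes "\<forall>p\<in>set ps. p dvd n"
  shows "of_nat (\<Prod>p\<leftarrow>ps. p ^ p) \<noteq> (0::'a)"
  using assms by (induction ps) (auto simp: of_nat_dvd_n_nz)

lemma omega_of_nat_prod_list_powers:
  assumes "\<forall>p\<in>set ps. p dvd n"
  shows "(\<Prod>p\<leftarrow>ps. \<omega> (of_nat p) powi (int p * int m)) = \<omega> (of_nat (\<Prod>p\<leftarrow>ps. p ^ p)) ^ m"
  using assms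
proof (induction ps)
  case (Cons p ps)
  have p: "of_nat p \<noteq> (0::'a)" using Cons.prems by (intro of_nat_dvd_n_nz) simp
  have ps: "of_nat (\<Prod>p\<leftarrow>ps. p ^ p) \<noteq> (0::'a)"
    using Cons.prems by (intro of_nat_prod_list_powers_nz) simp
  have "\<omega> (of_nat p ^ p * of_nat (\<Prod>p\<leftarrow>ps. p ^ p)) = \<omega> (of_nat p) ^ p * \<omega> (of_nat (\<Prod>p\<leftarrow>ps. p ^ p))"
    using p ps by (subst omega_mult) (auto simp: omega_power)
  moreover have "\<omega> (of_nat p) powi (int p * int m) = (\<omega> (of_nat p) ^ p) ^ m"
    by (simp add: power_int_mult)
  moreover have "(\<Prod>p\<leftarrow>ps. \<omega> (of_nat p) powi (int p * int m)) = \<omega> (of_nat (\<Prod>p\<leftarrow>ps. p ^ p)) ^ m"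
    using Cons by simp
  ultimately show ?case by (simp add: power_mult_distrib)
qed simp

lemma prod_list_uminus_mult:
  "(\<Prod>x\<leftarrow>xs. - (f x * g x)) = (-1) ^ length xs * (\<Prod>x\<leftarrow>xs. f x) * (\<Prod>x\<leftarrow>xs. g x :: complex)"
  by (induction xs) auto

lemma prod_list_power_mult:
  "(\<Prod>x\<leftarrow>xs. c ^ x * f x) = c ^ sum_list xs * (\<Prod>x\<leftarrow>xs. f x :: complex)"
  by (induction xs) (auto simp: power_add)

lemma prod_list_inverse_map:
  "(\<Prod>x\<leftarrow>xs. inverse (f x) :: complex) = inverse (\<Prod>x\<leftarrow>xs. f x)"
  by (induction xs) auto

text \<open>The two sums agree term by term: the zeros of the \<open>xpm1\<close> products are those
  belonging to \<open>as\<close> or \<open>bs\<close> together with those of \<open>D\<close>, and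
  the three groups are evaluated separately.\<close>

lemma hypergeometric_term:
  fixes as bs :: "rat list" and ps qs :: "nat list" and t :: 'a and m :: nat
  defines "D \<equiv> gcd (\<Prod>p\<leftarrow>ps. xpm1 p) (\<Prod>q\<leftarrow>qs. xpm1 q)"
  assumes len: "length as = length bs"
    and noncong: "\<forall>a\<in>set as. \<forall>b\<in>set bs. a - b \<notin> \<int>"
    and ratfun: "(\<Prod>a\<leftarrow>as. [:- expi a, 1:]) * (\<Prod>q\<leftarrow>qs. xpm1 q)
               = (\<Prod>b\<leftarrow>bs. [:- expi b, 1:]) * (\<Prod>p\<leftarrow>ps. xpm1 p)"
    and aint: "\<forall>a\<in>set as. a * of_nat n \<in> \<int>" and bint: "\<forall>b\<in>set bs. b * of_nat n \<in> \<int>"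
    and pdvd: "\<forall>p\<in>set ps. p dvd n" and qdvd: "\<forall>q\<in>set qs. q dvd n"
    and t: "t \<noteq> 0"
  shows "(\<Prod>i<length as. gauss \<psi> \<omega> (int m + \<lfloor>as ! i * of_nat n\<rfloor>) * gauss \<psi> \<omega> (- int m - \<lfloor>bs ! i * of_nat n\<rfloor>)
           / (gauss \<psi> \<omega> \<lfloor>as ! i * of_nat n\<rfloor> * gauss \<psi> \<omega> (- \<lfloor>bs ! i * of_nat n\<rfloor>)))
        * \<omega> ((-1) ^ length as * t) ^ m
    = (-1) ^ (length ps + length qs) * (of_nat q powi (int (order (unit_root (int m)) D) - int (order (unit_root 0) D))
           * (\<Prod>p\<leftarrow>ps. gauss \<psi> \<omega> (int (p * m)))
           * (\<Prod>q\<leftarrow>qs. gauss \<psi> \<omega> (- int (q * m)))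
           * \<omega> ((-1) ^ sum_list qs * (of_nat (\<Prod>q\<leftarrow>qs. q ^ q) / of_nat (\<Prod>p\<leftarrow>ps. p ^ p)) * t) ^ m)"
proof -
  define fl where "fl = (\<lambda>a::rat. \<lfloor>a * of_nat n\<rfloor>)"
  define U where "U = (\<lambda>c. gauss \<psi> \<omega> (int m + c) / gauss \<psi> \<omega> c)"
  \<comment> \<open>One sign is attached to each shift in \<open>V\<close>: over the entries of
    \<open>bs\<close> these signs absorb \<open>\<omega> ((-1) ^ length as) ^ m\<close>, and over
    the zeros of the \<open>xpm1 q\<close> they produce \<open>(-1) ^ sum_list qs\<close>.\<close>
  define V where "V = (\<lambda>c. \<omega> (-1) powi int m * gauss \<psi> \<omega> (- int m - c) / gauss \<psi> \<omega> (- c))"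
  define w where "w = \<omega> (-1) ^ m"
  have Uper: "U (c mod int n) = U c" for c
    unfolding U_def by (intro arg_cong2[of _ _ _ _ "(/)"] gauss_mod) (auto simp: mod_simps)
  have Vper: "V (c mod int n) = V c" for c
    unfolding V_def by (intro arg_cong2[of _ _ _ _ "(/)"] arg_cong2[of _ _ _ _ "(*)"] gauss_mod refl) (auto simp: mod_simps)
  have pos: "\<forall>p\<in>set ps \<union> set qs. 0 < p"
    using pdvd qdvd n_pos by (auto intro!: Nat.gr0I)
  note ord = order_hypergeometric_data[OF noncong ratfun aint bint pos, folded D_def]
  have conv: "(\<Prod>a\<leftarrow>xs. [:- expi a, 1:]) = (\<Prod>c\<leftarrow>map fl xs. [:- unit_root c, 1:])"
    if "\<forall>a\<in>set xs. a * of_nat n \<in> \<int>" for xs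
    using that by (auto simp: fl_def expi_eq_unit_root comp_def intro!: arg_cong[of _ _ prod_list])
  have XA: "(\<Prod>a\<leftarrow>as. U (fl a)) = (\<Prod>c\<in>residues. U c ^ order (unit_root c) (\<Prod>a\<leftarrow>as. [:- expi a, 1:]))"
    using prod_list_eq_prod_order[of U "map fl as"] Uper by (simp add: conv[OF aint] comp_def)
  have YB: "(\<Prod>b\<leftarrow>bs. V (fl b)) = (\<Prod>c\<in>residues. V c ^ order (unit_root c) (\<Prod>b\<leftarrow>bs. [:- expi b, 1:]))"
    using prod_list_eq_prod_order[of V "map fl bs"] Vper by (simp add: conv[OF bint] comp_def)
  have PU: "(\<Prod>p\<leftarrow>ps. \<Prod>j<p. U (int j * int (n div p))) = (\<Prod>a\<leftarrow>as. U (fl a)) * (\<Prod>c\<in>residues. U c ^ order (unit_root c) D)"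
    using pdvd by (subst prod_list_xpm1_eq_prod_order) (auto simp: XA ord power_add prod.distrib)
  have QV: "(\<Prod>p\<leftarrow>qs. \<Prod>j<p. V (int j * int (n div p))) = (\<Prod>b\<leftarrow>bs. V (fl b)) * (\<Prod>c\<in>residues. V c ^ order (unit_root c) D)"
    using qdvd by (subst prod_list_xpm1_eq_prod_order) (auto simp: YB ord power_add prod.distrib)
  \<comment> \<open>The reflected pairs yield the multiplicity of \<open>D\<close> at
    \<open>-m\<close>, while the conclusion has it at \<open>m\<close>.\<close>
  have sym: "order (unit_root (- int m mod int n)) D = order (unit_root (int m)) D"
  proof -
    have "unit_root (- int m mod int n) = unit_root (- int m)" by (simp add: unit_root_eq_iff)
    moreover have "(\<Prod>p\<leftarrow>ps. xpm1 p) \<noteq> 0" "(\<Prod>p\<leftarrow>qs. xpm1 p) \<noteq> 0"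
      using pos by (auto simp: prod_list_zero_iff xpm1_nz)
    ultimately show ?thesis using pos by (simp add: D_def order_gcd_poly order_prod_xpm1_uminus)
  qed
  have UV: "(\<Prod>c\<in>residues. U c ^ order (unit_root c) D) * (\<Prod>c\<in>residues. V c ^ order (unit_root c) D)
      = of_nat q powi (int (order (unit_root 0) D) - int (order (unit_root (int m)) D))"
    unfolding prod.distrib[symmetric] power_mult_distrib[symmetric] U_def V_def
    using prod_reflect_powers[of "int m" "\<lambda>c. order (unit_root c) D"] by (simp only: sym)
  have q0: "(of_nat q :: complex) \<noteq> 0" using q_eq by (simp del: of_nat_Suc)
  \<comment> \<open>\<open>Z'\<close> is the contribution of the zeros of \<open>D\<close> computed
    in \<open>UV\<close>; its inverse \<open>Z\<close> is the power of \<open>q\<close> in the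
    conclusion.\<close>
  define Z :: complex where "Z = of_nat q powi (int (order (unit_root (int m)) D) - int (order (unit_root 0) D))"
  define Z' :: complex where "Z' = of_nat q powi (int (order (unit_root 0) D) - int (order (unit_root (int m)) D))"
  have Z: "Z' * Z = 1" using q0 by (simp add: Z_def Z'_def flip: power_int_add)
  have XY: "(\<Prod>a\<leftarrow>as. U (fl a)) * (\<Prod>b\<leftarrow>bs. V (fl b)) =
     (\<Prod>p\<leftarrow>ps. \<Prod>j<p. U (int j * int (n div p))) * (\<Prod>p\<leftarrow>qs. \<Prod>j<p. V (int j * int (n div p))) * Z"
  proof -
    have "(\<Prod>p\<leftarrow>ps. \<Prod>j<p. U (int j * int (n div p))) * (\<Prod>p\<leftarrow>qs. \<Prod>j<p. V (int j * int (n div p))) * Z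
      = (\<Prod>a\<leftarrow>as. U (fl a)) * (\<Prod>b\<leftarrow>bs. V (fl b)) * (Z' * Z)"
      unfolding PU QV using UV by (simp add: Z'_def mult_ac)
    thus ?thesis by (simp add: Z)
  qed
  have np: "of_nat (\<Prod>p\<leftarrow>ps. p ^ p) \<noteq> (0::'a)" and nq: "of_nat (\<Prod>p\<leftarrow>qs. p ^ p) \<noteq> (0::'a)"
    using of_nat_prod_list_powers_nz[OF pdvd] of_nat_prod_list_powers_nz[OF qdvd] by blast+
  let ?Mp = "of_nat (\<Prod>p\<leftarrow>ps. p ^ p) :: 'a" and ?Mq = "of_nat (\<Prod>p\<leftarrow>qs. p ^ p) :: 'a"
  \<comment> \<open>Each \<open>p\<close> contributes a sign and an inverse power of
    \<open>\<omega> (of_nat p)\<close>; the latter collect to the denominator of the inverse of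
    \<open>M\<close>.\<close>
  have PU': "(\<Prod>p\<leftarrow>ps. \<Prod>j<p. U (int j * int (n div p))) =
      (-1) ^ length ps * inverse (\<omega> ?Mp ^ m) * (\<Prod>p\<leftarrow>ps. gauss \<psi> \<omega> (int (p * m)))"
  proof -
    have "(\<Prod>p\<leftarrow>ps. \<Prod>j<p. U (int j * int (n div p))) =
       (\<Prod>p\<leftarrow>ps. - (inverse (\<omega> (of_nat p) powi (int p * int m)) * gauss \<psi> \<omega> (int (p * m))))"
      using pdvd unfolding U_def
      by (intro arg_cong[of _ _ prod_list] map_cong refl, subst hasse_davenport_quotient) (auto simp: power_int_minus)
    also have "\<dots> = (-1) ^ length ps * (\<Prod>p\<leftarrow>ps. inverse (\<omega> (of_nat p) powi (int p * int m))) * (\<Prod>p\<leftarrow>ps. gauss \<psi> \<omega> (int (p * m)))"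
      by (rule prod_list_uminus_mult)
    finally show ?thesis
      by (simp only: prod_list_inverse_map omega_of_nat_prod_list_powers[OF pdvd])
  qed
  have QV': "(\<Prod>p\<leftarrow>qs. \<Prod>j<p. V (int j * int (n div p))) =
      (-1) ^ length qs * w ^ sum_list qs * \<omega> ?Mq ^ m * (\<Prod>p\<leftarrow>qs. gauss \<psi> \<omega> (- int (p * m)))"
  proof -
    have "(\<Prod>j<p. V (int j * int (n div p))) = w ^ p * (- (\<omega> (of_nat p) powi (int p * int m) * gauss \<psi> \<omega> (- int (p * m))))"
      if "p \<in> set qs" for p
    proof -
      have "(\<Prod>j<p. V (int j * int (n div p))) = w ^ p *
          (\<Prod>j<p. gauss \<psi> \<omega> (- int m - int j * int (n div p)) / gauss \<psi> \<omega> (- (int j * int (n div p))))"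
        unfolding V_def times_divide_eq_right[symmetric] prod.distrib by (simp add: w_def)
      thus ?thesis using qdvd that by (simp add: hasse_davenport_quotient_neg)
    qed
    hence "(\<Prod>p\<leftarrow>qs. \<Prod>j<p. V (int j * int (n div p))) =
       (\<Prod>p\<leftarrow>qs. w ^ p * (- (\<omega> (of_nat p) powi (int p * int m) * gauss \<psi> \<omega> (- int (p * m)))))"
      by (intro arg_cong[of _ _ prod_list] map_cong refl)
    also have "\<dots> = w ^ sum_list qs * ((-1) ^ length qs * (\<Prod>p\<leftarrow>qs. \<omega> (of_nat p) powi (int p * int m)) * (\<Prod>p\<leftarrow>qs. gauss \<psi> \<omega> (- int (p * m))))"
      by (simp only: prod_list_power_mult prod_list_uminus_mult)
    finally show ?thesis
      by (simp only: omega_of_nat_prod_list_powers[OF qdvd] mult_ac)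
  qed
  have LHS: "(\<Prod>i<length as. gauss \<psi> \<omega> (int m + fl (as ! i)) * gauss \<psi> \<omega> (- int m - fl (bs ! i))
           / (gauss \<psi> \<omega> (fl (as ! i)) * gauss \<psi> \<omega> (- fl (bs ! i)))) * \<omega> ((-1) ^ length as * t) ^ m
      = (\<Prod>a\<leftarrow>as. U (fl a)) * (\<Prod>b\<leftarrow>bs. V (fl b)) * \<omega> t ^ m"
  proof -
    have "(\<Prod>a\<leftarrow>as. U (fl a)) * (\<Prod>b\<leftarrow>bs. V (fl b)) = (\<Prod>i<length as. U (fl (as ! i)) * V (fl (bs ! i)))"
      by (simp add: prod.list_conv_set_nth len prod.distrib lessThan_atLeast0)
    also have "\<dots> = (\<Prod>i<length as. w * (gauss \<psi> \<omega> (int m + fl (as ! i)) * gauss \<psi> \<omega> (- int m - fl (bs ! i))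
           / (gauss \<psi> \<omega> (fl (as ! i)) * gauss \<psi> \<omega> (- fl (bs ! i)))))"
      by (rule prod.cong) (simp_all add: U_def V_def w_def)
    also have "\<dots> = w ^ length as * (\<Prod>i<length as. gauss \<psi> \<omega> (int m + fl (as ! i)) * gauss \<psi> \<omega> (- int m - fl (bs ! i))
           / (gauss \<psi> \<omega> (fl (as ! i)) * gauss \<psi> \<omega> (- fl (bs ! i))))"
      by (simp only: prod.distrib prod_constant card_lessThan)
    finally have 1: "(\<Prod>a\<leftarrow>as. U (fl a)) * (\<Prod>b\<leftarrow>bs. V (fl b)) = \<dots>" .
    have "\<omega> ((-1) ^ length as * t) ^ m = w ^ length as * \<omega> t ^ m"
      using t by (simp add: omega_mult omega_power power_mult_distrib w_def mult.commute flip: power_mult)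
    thus ?thesis unfolding 1 by (simp only: mult_ac)
  qed
  have "\<omega> ((-1) ^ k * (x / y) * t) = \<omega> (-1) ^ k * (\<omega> x * inverse (\<omega> y)) * \<omega> t"
    if "x \<noteq> 0" "y \<noteq> 0" for x y k
    using that t by (simp add: divide_inverse omega_mult omega_power omega_inverse)
  from this[OF nq np, of "sum_list qs"]
  have RHS: "\<omega> ((-1) ^ sum_list qs * (?Mq / ?Mp) * t) ^ m = w ^ sum_list qs * (\<omega> ?Mq ^ m * inverse (\<omega> ?Mp ^ m)) * \<omega> t ^ m"
    by (simp only: power_mult_distrib power_inverse w_def power_mult[symmetric] mult.commute[of m])
  show ?thesis
    unfolding LHS[unfolded fl_def] unfolding XY[unfolded fl_def] PU' QV' RHS Z_def[symmetric] power_add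
    by (simp only: mult_ac)
qed

end

text \<open>The identity of rational functions is cross-multiplied in \<open>ratfun\<close>. The
  inverse of \<open>M\<close> is formed inside the finite field, where all \<open>p\<close> and
  \<open>q\<close> are nonzero because they divide the order of the multiplicative group.\<close>

theorem mainTheorem2:
  fixes \<psi> \<omega> :: "'a::{finite,field} \<Rightarrow> complex"
    and as bs :: "rat list" and ps qs :: "nat list" and t :: 'a
  assumes psi: "nontrivial_add_char \<psi>"
    and omega: "generating_char \<omega>"
    and len: "length as = length bs"
    and noncong: "\<forall>a\<in>set as. \<forall>b\<in>set bs. a - b \<notin> \<int>"
    and ppos: "\<forall>p\<in>set ps. 0 < p" and qpos: "\<forall>q\<in>set qs. 0 < q"
    and gcd1: "Gcd (set ps \<union> set qs) = 1"
    and ratfun: "(\<Prod>a\<leftarrow>as. [:- expi a, 1:]) * (\<Prod>q\<leftarrow>qs. xpm1 q)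
               = (\<Prod>b\<leftarrow>bs. [:- expi b, 1:]) * (\<Prod>p\<leftarrow>ps. xpm1 p)"
    and primepow: "\<exists>p k. prime p \<and> 0 < k \<and> card (UNIV :: 'a set) = p ^ k"
    and aint: "\<forall>a\<in>set as. a * of_nat (card (UNIV :: 'a set) - 1) \<in> \<int>"
    and bint: "\<forall>b\<in>set bs. b * of_nat (card (UNIV :: 'a set) - 1) \<in> \<int>"
    and pdvd: "\<forall>p\<in>set ps. p dvd card (UNIV :: 'a set) - 1"
    and qdvd: "\<forall>q\<in>set qs. q dvd card (UNIV :: 'a set) - 1"
    and t: "t \<noteq> 0"
  shows "hyp_sum \<psi> \<omega> as bs t =
    (-1) ^ (length ps + length qs) / (1 - of_nat (card (UNIV :: 'a set))) *
    (\<Sum>m = 0..card (UNIV :: 'a set) - 2.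
       (let D = gcd (\<Prod>p\<leftarrow>ps. xpm1 p) (\<Prod>q\<leftarrow>qs. xpm1 q);
            s = (\<lambda>k::nat. order (exp (2 * of_real pi * \<i> * of_nat k / of_nat (card (UNIV :: 'a set) - 1))) D);
            Minv = (of_nat (\<Prod>q\<leftarrow>qs. q ^ q) / of_nat (\<Prod>p\<leftarrow>ps. p ^ p) :: 'a);
            \<epsilon> = ((-1) ^ sum_list qs :: 'a)
        in of_nat (card (UNIV :: 'a set)) powi (int (s m) - int (s 0))
           * (\<Prod>p\<leftarrow>ps. gauss \<psi> \<omega> (int (p * m)))
           * (\<Prod>q\<leftarrow>qs. gauss \<psi> \<omega> (- int (q * m)))
           * \<omega> (\<epsilon> * Minv * t) ^ m))"
proof -
  interpret field_characters \<psi> \<omega> by unfold_locales (fact psi omega primepow)+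
  have q: "card (UNIV :: 'a set) = q" and n: "q - 1 = n" by (simp_all add: q_def n_def)
  note term_eq = hypergeometric_term[OF len noncong ratfun aint[unfolded q n] bint[unfolded q n]
      pdvd[unfolded q n] qdvd[unfolded q n] t]
  show ?thesis
    unfolding hyp_sum_def q n Let_def exp_eq_unit_root term_eq sum_distrib_left[symmetric] of_nat_0
    by simp
qed

end
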